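(* There exists a Super Harmonic algorithm $\mathcal A$ (where more than one red item per bin is allowed) whose asymptotic competitive ratio satisfies $\mathcal R^\infty_{\mathcal A}\le 1.5884$.
   Context: Online bin packing: a finite sequence $\sigma$ of items with sizes in $(0,1]$ arrives one by one; each must be irrevocably assigned to a bin of capacity $1$ before the next one becomes available. $\mathcal A(\sigma)$ is the number of bins used by algorithm $\mathcal A$ on $\sigma$, $\mathrm{opt}(\sigma)$ the offline optimum, and $$\mathcal R^{\infty}_{\mathcal A}=\limsup_{n\to\infty}\sup_\sigma\{\mathcal A(\sigma)/\mathrm{opt}(\sigma) : \mathrm{opt}(\sigma)=n\}.$$ Super Harmonic algorithms. Parameters: an integer $N$; thresholds $1=t_1\ge t_2\ge\dots\ge t_N>0$; a finite list of spaces $\mathrm{redspace}_1\le\dots\le\mathrm{redspace}_K$ in $(0,1)$; fractions $\mathrm{red}_j\in[0,1]$ for each type $j$; functions $\mathrm{leaves},\mathrm{needs}:\{1,\dots,N\}\to\{0,\dots,K\}$. An item has type $j<N$ if its size lies in $(t_{j+1},t_j]$ and type $N$ if its size lies in $(0,t_N]$. Put $\mathrm{bluefit}_j=\lfloor 1/t_j\rfloor$. It is required that $\mathrm{needs}(j)=0$ if and only if $\mathrm{red}_j=0$; if $\mathrm{red}_j>0$ then $\mathrm{redfit}_j=\lfloor \mathrm{redspace}_{\mathrm{needs}(j)}/t_j\rfloor\ge1$; if $\mathrm{leaves}(j)>0$ then $\mathrm{redspace}_{\mathrm{leaves}(j)}\le 1-\mathrm{bluefit}_j t_j$ ($\mathrm{leaves}(j)=0$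 means that no space is left for red items). Items of type $N$ are packed by Next Fit into bins used only for type $N$. For each type $i<N$ maintain counters $n^i$ (items of type $i$) and $n^i_{\mathrm{red}}$ (red items of type $i$), initially $0$. When an item of type $i<N$ arrives, set $n^i\gets n^i+1$. If $n^i_{\mathrm{red}}<\lfloor \mathrm{red}_i n^i\rfloor$, the item is colored $c=$ red and $n^i_{\mathrm{red}}\gets n^i_{\mathrm{red}}+1$; otherwise it is colored $c=$ blue. It is then placed in the first available kind of bin among: (1) a $c$-open bin that contains items of type $i$ and color $c$; (2) an unmixed bin compatible with it (which thereby becomes mixed); (3) a new bin, which is pure blue if $c$ is blue and $\mathrm{leaves}(i)=0$, and unmixed otherwise. A bin holds at most $\mathrm{bluefit}_i$ blue items if its blue items have type $i$, and at most $\mathrm{redfit}_j$ red items if its red items have type $j$; a bin is blue-open (red-open) if it contains at least one blue (red) item but fewer than this maximum. Pure blue bins only ever contain blue items of one type; an unmixed bin is a bin that is not pure blue and contains items of only one type and color; a mixed bin contains blue items of one type and red items of another. An unmixed bin with blue items of type $j$ is compatible with a red item of type $i$ if $\mathrm{needs}(i)\le\mathrm{leaves}(j)$; an unmixed bin with red items of type $j$ is compatible with a blue item of type $i$ if $\mathrm{needs}(j)\le\mathrm{leaves}(i)$. *)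

theory Defs
  imports "HOL-Analysis.Analysis"
begin

section \<open>Online bin packing\<close>

definition bp_input :: "real list \<Rightarrow> bool" where
  "bp_input \<sigma> \<longleftrightarrow> (\<forall>s\<in>set \<sigma>. 0 < s \<and> s \<le> 1)"

definition opt :: "real list \<Rightarrow> nat" where
  "opt \<sigma> = (LEAST m. \<exists>f. (\<forall>k<length \<sigma>. f k < m) \<and>
                          (\<forall>b<m. (\<Sum>k\<in>{k. k < length \<sigma> \<and> f k = b}. \<sigma> ! k) \<le> (1::real)))"

text \<open>
  An algorithm maps a nonempty history of items (the last one being the current item) to the
  name of the bin receiving the current item. The algorithm is online since it sees nothing but
  the history, and its decisions are irrevocable since bin contents are computed from the
  decisions made on the prefixes.
\<close>

type_synonym bp_alg = "real list \<Rightarrow> nat"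

definition bin_of :: "bp_alg \<Rightarrow> real list \<Rightarrow> nat \<Rightarrow> nat" where
  "bin_of A \<sigma> k = A (take (Suc k) \<sigma>)"

definition bin_items :: "bp_alg \<Rightarrow> real list \<Rightarrow> nat \<Rightarrow> nat set" where
  "bin_items A \<sigma> b = {k. k < length \<sigma> \<and> bin_of A \<sigma> k = b}"

definition level :: "bp_alg \<Rightarrow> real list \<Rightarrow> nat \<Rightarrow> real" where
  "level A \<sigma> b = (\<Sum>k\<in>bin_items A \<sigma> b. \<sigma> ! k)"

definition online_bin_packing :: "bp_alg \<Rightarrow> bool" where
  "online_bin_packing A \<longleftrightarrow> (\<forall>\<sigma> b. bp_input \<sigma> \<longrightarrow> level A \<sigma> b \<le> 1)"

definition bins_used :: "bp_alg \<Rightarrow> real list \<Rightarrow> nat" where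
  "bins_used A \<sigma> = card {b. bin_items A \<sigma> b \<noteq> {}}"

definition asymptotic_ratio :: "bp_alg \<Rightarrow> ereal" where
  "asymptotic_ratio A =
     limsup (\<lambda>n. SUP \<sigma>\<in>{\<sigma>. bp_input \<sigma> \<and> opt \<sigma> = n}.
                   ereal (real (bins_used A \<sigma>) / real (opt \<sigma>)))"

section \<open>Parameters of Super Harmonic algorithms\<close>

text \<open>
  Types are the numbers \<open>1, \<dots>, ntypes\<close> and spaces the numbers \<open>1, \<dots>, nspaces\<close>; the values of
  the functions outside these ranges are irrelevant.
\<close>

record sh_params =
  ntypes :: nat
  thr :: "nat \<Rightarrow> real"
  nspaces :: nat
  redspace :: "nat \<Rightarrow> real"
  red :: "nat \<Rightarrow> real"
  leaves :: "nat \<Rightarrow> nat"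
  needs :: "nat \<Rightarrow> nat"

definition bluefit :: "sh_params \<Rightarrow> nat \<Rightarrow> nat" where
  "bluefit P j = nat \<lfloor>1 / thr P j\<rfloor>"

definition redfit :: "sh_params \<Rightarrow> nat \<Rightarrow> nat" where
  "redfit P j = nat \<lfloor>redspace P (needs P j) / thr P j\<rfloor>"

definition sh_params_ok :: "sh_params \<Rightarrow> bool" where
  "sh_params_ok P \<longleftrightarrow>
     ntypes P \<ge> 1 \<and>
     thr P 1 = 1 \<and>
     (\<forall>j. 1 \<le> j \<and> j < ntypes P \<longrightarrow> thr P (Suc j) \<le> thr P j) \<and>
     thr P (ntypes P) > 0 \<and>
     (\<forall>k. 1 \<le> k \<and> k \<le> nspaces P \<longrightarrow> 0 < redspace P k \<and> redspace P k < 1) \<and>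
     (\<forall>k. 1 \<le> k \<and> k < nspaces P \<longrightarrow> redspace P k \<le> redspace P (Suc k)) \<and>
     (\<forall>j. 1 \<le> j \<and> j \<le> ntypes P \<longrightarrow>
        0 \<le> red P j \<and> red P j \<le> 1 \<and>
        leaves P j \<le> nspaces P \<and> needs P j \<le> nspaces P \<and>
        (needs P j = 0 \<longleftrightarrow> red P j = 0) \<and>
        (red P j > 0 \<longrightarrow> redfit P j \<ge> 1) \<and>
        (leaves P j > 0 \<longrightarrow>
           redspace P (leaves P j) \<le> 1 - real (bluefit P j) * thr P j))"

definition has_type :: "sh_params \<Rightarrow> real \<Rightarrow> nat \<Rightarrow> bool" where
  "has_type P s j \<longleftrightarrow>
     (1 \<le> j \<and> j < ntypes P \<and> thr P (Suc j) < s \<and> s \<le> thr P j) \<or>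
     (j = ntypes P \<and> 0 < s \<and> s \<le> thr P j)"

definition item_type :: "sh_params \<Rightarrow> real \<Rightarrow> nat" where
  "item_type P s = (THE j. has_type P s j)"

section \<open>Colouring\<close>

datatype colour = Blue | Red

text \<open>The counters for type \<open>i\<close> after the arrival of the first \<open>k\<close> items of \<open>\<sigma>\<close>.\<close>

definition n_items :: "sh_params \<Rightarrow> real list \<Rightarrow> nat \<Rightarrow> nat \<Rightarrow> nat" where
  "n_items P \<sigma> i k = card {l. l < k \<and> item_type P (\<sigma> ! l) = i}"

primrec n_red :: "sh_params \<Rightarrow> real list \<Rightarrow> nat \<Rightarrow> nat \<Rightarrow> nat" where
  "n_red P \<sigma> i 0 = 0"
| "n_red P \<sigma> i (Suc k) =
     (if item_type P (\<sigma> ! k) = i \<and> int (n_red P \<sigma> i k) < \<lfloor>red P i * real (n_items P \<sigma> i (Suc k))\<rfloor>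
      then n_red P \<sigma> i k + 1 else n_red P \<sigma> i k)"

text \<open>The colour is meaningful only for items of a type below \<open>ntypes P\<close>.\<close>

definition colour_of :: "sh_params \<Rightarrow> real list \<Rightarrow> nat \<Rightarrow> colour" where
  "colour_of P \<sigma> k =
     (let i = item_type P (\<sigma> ! k)
      in if int (n_red P \<sigma> i k) < \<lfloor>red P i * real (n_items P \<sigma> i (Suc k))\<rfloor> then Red else Blue)"

section \<open>Packing rules\<close>

definition new_bin :: "bp_alg \<Rightarrow> real list \<Rightarrow> nat \<Rightarrow> bool" where
  "new_bin A \<sigma> b \<longleftrightarrow> bin_items A \<sigma> b = {}"

definition cfit :: "sh_params \<Rightarrow> colour \<Rightarrow> nat \<Rightarrow> nat" where
  "cfit P c i = (case c of Blue \<Rightarrow> bluefit P i | Red \<Rightarrow> redfit P i)"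

definition typed_items :: "sh_params \<Rightarrow> bp_alg \<Rightarrow> real list \<Rightarrow> nat \<Rightarrow> nat \<Rightarrow> colour \<Rightarrow> nat set" where
  "typed_items P A \<sigma> b i c =
     {k \<in> bin_items A \<sigma> b. item_type P (\<sigma> ! k) = i \<and> colour_of P \<sigma> k = c}"

text \<open>\<open>b\<close> is \<open>c\<close>-open and its items of colour \<open>c\<close> have type \<open>i\<close>.\<close>

definition open_bin :: "sh_params \<Rightarrow> bp_alg \<Rightarrow> real list \<Rightarrow> nat \<Rightarrow> nat \<Rightarrow> colour \<Rightarrow> bool" where
  "open_bin P A \<sigma> b i c \<longleftrightarrow>
     0 < card (typed_items P A \<sigma> b i c) \<and> card (typed_items P A \<sigma> b i c) < cfit P c i"

text \<open>Whether a bin is pure blue is decided by the item that opened it.\<close>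

definition pure_blue :: "sh_params \<Rightarrow> bp_alg \<Rightarrow> real list \<Rightarrow> nat \<Rightarrow> bool" where
  "pure_blue P A \<sigma> b \<longleftrightarrow>
     bin_items A \<sigma> b \<noteq> {} \<and>
     (let k = Min (bin_items A \<sigma> b); i = item_type P (\<sigma> ! k)
      in i < ntypes P \<and> colour_of P \<sigma> k = Blue \<and> leaves P i = 0)"

definition unmixed :: "sh_params \<Rightarrow> bp_alg \<Rightarrow> real list \<Rightarrow> nat \<Rightarrow> nat \<Rightarrow> colour \<Rightarrow> bool" where
  "unmixed P A \<sigma> b j c \<longleftrightarrow>
     j < ntypes P \<and> \<not> pure_blue P A \<sigma> b \<and>
     bin_items A \<sigma> b \<noteq> {} \<and> bin_items A \<sigma> b = typed_items P A \<sigma> b j c"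

definition compatible :: "sh_params \<Rightarrow> bp_alg \<Rightarrow> real list \<Rightarrow> nat \<Rightarrow> nat \<Rightarrow> colour \<Rightarrow> bool" where
  "compatible P A \<sigma> b i c \<longleftrightarrow>
     (case c of
        Red \<Rightarrow> (\<exists>j. unmixed P A \<sigma> b j Blue \<and> needs P i \<le> leaves P j)
      | Blue \<Rightarrow> (\<exists>j. unmixed P A \<sigma> b j Red \<and> needs P j \<le> leaves P i))"

text \<open>
  The current bin of Next Fit is the one containing the most recent item of the smallest type.
\<close>

definition next_fit_rule :: "sh_params \<Rightarrow> bp_alg \<Rightarrow> real list \<Rightarrow> real \<Rightarrow> nat \<Rightarrow> bool" where
  "next_fit_rule P A \<sigma> s b \<longleftrightarrow>
     (let T = {k. k < length \<sigma> \<and> item_type P (\<sigma> ! k) = ntypes P}; cur = bin_of A \<sigma> (Max T)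
      in if T \<noteq> {} \<and> level A \<sigma> cur + s \<le> 1 then b = cur else new_bin A \<sigma> b)"

definition coloured_rule ::
    "sh_params \<Rightarrow> bp_alg \<Rightarrow> real list \<Rightarrow> nat \<Rightarrow> colour \<Rightarrow> nat \<Rightarrow> bool" where
  "coloured_rule P A \<sigma> i c b \<longleftrightarrow>
     (if \<exists>b'. open_bin P A \<sigma> b' i c then open_bin P A \<sigma> b i c
      else if \<exists>b'. compatible P A \<sigma> b' i c then compatible P A \<sigma> b i c
      else new_bin A \<sigma> b)"

text \<open>
  When several bins of the preferred kind are available, the rules do not say which one is used:
  every way of breaking ties gives a Super Harmonic algorithm.
\<close>

definition super_harmonic :: "sh_params \<Rightarrow> bp_alg \<Rightarrow> bool" where
  "super_harmonic P A \<longleftrightarrow>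
     (\<forall>\<sigma> s. bp_input (\<sigma> @ [s]) \<longrightarrow>
        (let i = item_type P s; b = A (\<sigma> @ [s])
         in if i = ntypes P then next_fit_rule P A \<sigma> s b
            else coloured_rule P A \<sigma> i (colour_of P (\<sigma> @ [s]) (length \<sigma>)) b))"

end

theory Submission imports Defs begin

text \<open>
  Once the last item is packed, no unmixed red bin is compatible with an unmixed blue bin. Let
  \<open>k\<close> be the least value of \<open>needs\<close> over the types of unmixed red bins. Then unmixed blue bins have
  types with \<open>leaves\<close> below \<open>k\<close>, so the bins can be counted in two ways: as all bins with red items
  together with the bins whose blue type has \<open>leaves < k\<close>, or as all bins with blue items together
  with the bins whose red type has \<open>needs \<ge> k\<close>. A convex combination of the two counts gives, for
  every \<open>k\<close>, a weight function on item sizes whose total bounds the number of bins up to a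
  constant; if there is no unmixed red bin, the bins with blue items alone suffice. It remains to
  bound, for each of these weight functions, the weight of a set of items that fits into one bin.
  With 31 types besides the smallest one (``sand'') and 10 spaces these are 11 small knapsack
  problems, solved by branch and bound. The parameters were found by numerical optimisation.
\<close>

section \<open>Existence of a Super Harmonic algorithm\<close>

text \<open>Both counts are linear in the numbers of items of each type, but the smaller of the two
  is not. Bounding it separately on each bin of an optimal packing would not bound it in total,
  since the minimum of two sums can exceed the sum of the minima. A fixed convex combination is
  linear and splits over the optimal bins; its coefficient \<open>lam\<close> acts as a dual
  multiplier and may depend on \<open>k\<close> but not on the input.

  The thresholds strictly between 1/3 and 2/3, apart from 1/2, come in pairs with sum 1: a blue item
  of size at most 0.584 leaves exactly the space 0.416 for a red item of the type with that
  threshold, and so on up to 0.665 and 0.335. Spaces up to 0.308 serve red items of size at most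
  0.288, up to five of them in one bin; such spaces are left beside two blue items from (1/3,
  0.416].\<close>

definition sh_rule :: "sh_params \<Rightarrow> bp_alg \<Rightarrow> real list \<Rightarrow> real \<Rightarrow> nat \<Rightarrow> bool" where
  "sh_rule P A \<sigma> s b \<longleftrightarrow>
     (if item_type P s = ntypes P then next_fit_rule P A \<sigma> s b
      else coloured_rule P A \<sigma> (item_type P s) (colour_of P (\<sigma> @ [s]) (length \<sigma>)) b)"

lemma super_harmonic_iff:
  "super_harmonic P A \<longleftrightarrow> (\<forall>\<sigma> s. bp_input (\<sigma> @ [s]) \<longrightarrow> sh_rule P A \<sigma> s (A (\<sigma> @ [s])))"
  by (simp add: super_harmonic_def sh_rule_def Let_def)

lemma finite_bin_items [simp]: "finite (bin_items A \<sigma> b)"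
  by (simp add: bin_items_def)

lemma finite_typed_items [simp]: "finite (typed_items P A \<sigma> b i c)"
  by (simp add: typed_items_def)

lemma ex_new_bin: "\<exists>b. new_bin A \<sigma> b"
proof -
  obtain b where "b \<notin> bin_of A \<sigma> ` {..<length \<sigma>}"
    using ex_new_if_finite[OF infinite_UNIV_nat, of "bin_of A \<sigma> ` {..<length \<sigma>}"] by auto
  then have "bin_items A \<sigma> b = {}"
    by (auto simp: bin_items_def)
  then show ?thesis by (auto simp: new_bin_def)
qed

lemma ex_sh_rule: "\<exists>b. sh_rule P A \<sigma> s b"
proof (cases "item_type P s = ntypes P")
  case True
  then show ?thesis
    using ex_new_bin[of A \<sigma>] unfolding sh_rule_def next_fit_rule_def Let_def by auto
next
  case False
  let ?i = "item_type P s" and ?c = "colour_of P (\<sigma> @ [s]) (length \<sigma>)"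
  have "\<exists>b. coloured_rule P A \<sigma> ?i ?c b"
    using ex_new_bin[of A \<sigma>] unfolding coloured_rule_def
    by (cases "\<exists>b. open_bin P A \<sigma> b ?i ?c"; cases "\<exists>b. compatible P A \<sigma> b ?i ?c") simp_all
  with False show ?thesis by (simp add: sh_rule_def)
qed

text \<open>The rule sees the algorithm only through the bins of the items already packed. Hence the
  decision for a history is specified by those on shorter histories, and an algorithm can be built
  by recursion although the rules refer to the algorithm itself.\<close>

lemma sh_rule_cong:
  assumes "\<And>k. k < length \<sigma> \<Longrightarrow> bin_of A \<sigma> k = bin_of A' \<sigma> k"
  shows "sh_rule P A \<sigma> s b = sh_rule P A' \<sigma> s b"
proof -
  have items: "bin_items A \<sigma> = bin_items A' \<sigma>"
    using assms by (auto simp: bin_items_def fun_eq_iff)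
  have typed: "typed_items P A \<sigma> = typed_items P A' \<sigma>"
    by (simp add: typed_items_def items fun_eq_iff)
  have "unmixed P A \<sigma> = unmixed P A' \<sigma>"
    by (simp add: unmixed_def pure_blue_def items typed fun_eq_iff)
  then have comp: "compatible P A \<sigma> = compatible P A' \<sigma>"
    by (intro ext) (simp add: compatible_def split: colour.split)
  have "open_bin P A \<sigma> = open_bin P A' \<sigma>"
    by (simp add: open_bin_def typed fun_eq_iff)
  with comp have col: "coloured_rule P A \<sigma> i c b = coloured_rule P A' \<sigma> i c b" for i c
    by (simp add: coloured_rule_def new_bin_def items)
  let ?T = "{k. k < length \<sigma> \<and> item_type P (\<sigma> ! k) = ntypes P}"
  have "bin_of A \<sigma> (Max ?T) = bin_of A' \<sigma> (Max ?T)" if "?T \<noteq> {}"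
    using Max_in[of ?T] that assms by auto
  then have "next_fit_rule P A \<sigma> s b = next_fit_rule P A' \<sigma> s b"
    unfolding next_fit_rule_def Let_def level_def new_bin_def items by (cases "?T = {}") simp_all
  with col show ?thesis by (simp add: sh_rule_def)
qed

text \<open>The argument is the history in reverse order; the result decides all its prefixes.\<close>

primrec sh_build :: "sh_params \<Rightarrow> real list \<Rightarrow> bp_alg" where
  "sh_build P [] = (\<lambda>_. 0)"
| "sh_build P (s # \<tau>) =
     (sh_build P \<tau>)(rev (s # \<tau>) := SOME b. sh_rule P (sh_build P \<tau>) (rev \<tau>) s b)"

definition sh_alg :: "sh_params \<Rightarrow> bp_alg" where
  "sh_alg P \<sigma> = sh_build P (rev \<sigma>) \<sigma>"

text \<open>Prepending \<tau>' redefines only histories longer than \<tau>, so a decision once made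
  stays fixed.\<close>

lemma sh_build_append: "length \<rho> \<le> length \<tau> \<Longrightarrow> sh_build P (\<tau>' @ \<tau>) \<rho> = sh_build P \<tau> \<rho>"
  by (induction \<tau>') auto

lemma bin_of_sh_alg:
  assumes "k < length \<sigma>"
  shows "bin_of (sh_alg P) \<sigma> k = bin_of (sh_build P (rev \<sigma>)) \<sigma> k"
proof -
  have "rev \<sigma> = rev (drop (Suc k) \<sigma>) @ rev (take (Suc k) \<sigma>)"
    by (metis append_take_drop_id rev_append)
  then show ?thesis
    using assms by (metis bin_of_def sh_alg_def sh_build_append length_rev order_refl)
qed

lemma super_harmonic_sh_alg: "super_harmonic P (sh_alg P)"
proof -
  have "sh_rule P (sh_alg P) \<sigma> s (sh_alg P (\<sigma> @ [s]))" for \<sigma> s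
  proof -
    have "sh_alg P (\<sigma> @ [s]) = (SOME b. sh_rule P (sh_build P (rev \<sigma>)) \<sigma> s b)"
      by (simp add: sh_alg_def)
    then have "sh_rule P (sh_build P (rev \<sigma>)) \<sigma> s (sh_alg P (\<sigma> @ [s]))"
      using someI_ex[OF ex_sh_rule] by metis
    then show ?thesis
      using sh_rule_cong[of \<sigma> "sh_alg P" "sh_build P (rev \<sigma>)"] bin_of_sh_alg by blast
  qed
  then show ?thesis by (simp add: super_harmonic_iff)
qed

text \<open>One bin per item is a packing, so the minimum that defines \<open>opt\<close> is
  attained.\<close>

lemma opt_packing:
  assumes "bp_input \<sigma>"
  shows "\<exists>f. (\<forall>k<length \<sigma>. f k < opt \<sigma>) \<and>
    (\<forall>b<opt \<sigma>. (\<Sum>k | k < length \<sigma> \<and> f k = b. \<sigma> ! k) \<le> 1)"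
  unfolding opt_def
proof (rule LeastI_ex, intro exI conjI allI impI)
  fix b assume b: "b < length \<sigma>"
  then have "{k. k < length \<sigma> \<and> id k = b} = {b}" by auto
  then show "(\<Sum>k | k < length \<sigma> \<and> id k = b. \<sigma> ! k) \<le> 1"
    using assms b by (simp add: bp_input_def)
qed simp

section \<open>Invariants of a run\<close>

lemma n_items_append: "k \<le> length \<sigma> \<Longrightarrow> n_items P (\<sigma> @ \<tau>) i k = n_items P \<sigma> i k"
  unfolding n_items_def by (rule arg_cong[where f = card]) (auto simp: nth_append)

lemma n_red_append: "k \<le> length \<sigma> \<Longrightarrow> n_red P (\<sigma> @ \<tau>) i k = n_red P \<sigma> i k"
  by (induction k) (auto simp: n_items_append nth_append)

lemma colour_of_append: "k < length \<sigma> \<Longrightarrow> colour_of P (\<sigma> @ \<tau>) k = colour_of P \<sigma> k"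
  by (simp add: colour_of_def n_items_append n_red_append nth_append Let_def)

lemma n_items_Suc:
  "n_items P \<sigma> i (Suc k) = n_items P \<sigma> i k + (if item_type P (\<sigma> ! k) = i then 1 else 0)"
proof -
  have "{l. l < Suc k \<and> item_type P (\<sigma> ! l) = i} =
      {l. l < k \<and> item_type P (\<sigma> ! l) = i} \<union> (if item_type P (\<sigma> ! k) = i then {k} else {})"
    by (auto simp: less_Suc_eq)
  then show ?thesis by (simp add: n_items_def)
qed

text \<open>As \<open>red P i\<close> is at most 1, the floor rises by at most 1 with each arriving
  item of the type, so colouring that single item red is enough to catch up.\<close>

lemma n_red_eq_floor:
  assumes "0 \<le> red P i" "red P i \<le> 1"
  shows "int (n_red P \<sigma> i k) = \<lfloor>red P i * real (n_items P \<sigma> i k)\<rfloor>"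
proof (induction k)
  case 0
  then show ?case by (simp add: n_items_def)
next
  case (Suc k)
  let ?x = "red P i * real (n_items P \<sigma> i k)"
  have "\<lfloor>?x\<rfloor> \<le> \<lfloor>?x + red P i\<rfloor>" "\<lfloor>?x + red P i\<rfloor> \<le> \<lfloor>?x\<rfloor> + 1"
    using assms by linarith+
  with Suc show ?case by (auto simp: n_items_Suc algebra_simps)
qed

lemma card_red_items:
  "card {l. l < k \<and> item_type P (\<sigma> ! l) = i \<and> colour_of P \<sigma> l = Red} = n_red P \<sigma> i k"
proof (induction k)
  case (Suc k)
  let ?S = "\<lambda>k. {l. l < k \<and> item_type P (\<sigma> ! l) = i \<and> colour_of P \<sigma> l = Red}"
  have "?S (Suc k) = ?S k \<union> (if item_type P (\<sigma> ! k) = i \<and> colour_of P \<sigma> k = Red then {k} else {})"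
    by (auto simp: less_Suc_eq)
  with Suc show ?case by (auto simp: colour_of_def Let_def)
qed simp

locale super_harmonic_run =
  fixes P :: sh_params and A :: bp_alg
  assumes ok: "sh_params_ok P" and sh: "super_harmonic P A"
begin

section \<open>Thresholds and item types\<close>

lemma N_ge_1: "1 \<le> ntypes P"
  using ok by (simp add: sh_params_ok_def)

lemma thr_antimono:
  assumes "1 \<le> i" "i \<le> j" "j \<le> ntypes P"
  shows "thr P j \<le> thr P i"
  using assms(2,3)
proof (induction j rule: dec_induct)
  case (step n)
  then have "thr P (Suc n) \<le> thr P n"
    using ok assms(1) by (simp add: sh_params_ok_def)
  with step show ?case by simp
qed simp

lemma thr_pos: "1 \<le> i \<Longrightarrow> i \<le> ntypes P \<Longrightarrow> 0 < thr P i"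
  using thr_antimono[of i "ntypes P"] ok by (auto simp: sh_params_ok_def)

lemma thr_le_1: "1 \<le> i \<Longrightarrow> i \<le> ntypes P \<Longrightarrow> thr P i \<le> 1"
  using thr_antimono[of 1 i] ok by (auto simp: sh_params_ok_def)

lemma red_props:
  assumes "1 \<le> i" "i \<le> ntypes P"
  shows "0 \<le> red P i" "red P i \<le> 1" "leaves P i \<le> nspaces P" "needs P i \<le> nspaces P"
    "needs P i = 0 \<longleftrightarrow> red P i = 0" "red P i > 0 \<Longrightarrow> redfit P i \<ge> 1"
    "leaves P i > 0 \<Longrightarrow> redspace P (leaves P i) \<le> 1 - real (bluefit P i) * thr P i"
  using ok assms by (auto simp: sh_params_ok_def)

lemma has_type_unique:
  assumes "has_type P s i" "has_type P s j"
  shows "i = j"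
proof -
  have False if "has_type P s i" "has_type P s j" "i < j" for i j
  proof -
    have "1 \<le> i" "i < ntypes P" "thr P (Suc i) < s" "s \<le> thr P j" "j \<le> ntypes P"
      using that by (auto simp: has_type_def)
    with thr_antimono[of "Suc i" j] that(3) show False by simp
  qed
  with assms show ?thesis by (metis linorder_neqE_nat)
qed

lemma has_type_ex:
  assumes "0 < s" "s \<le> 1"
  shows "\<exists>i. has_type P s i"
proof -
  define J where "J = {j. 1 \<le> j \<and> j \<le> ntypes P \<and> s \<le> thr P j}"
  have "finite J" by (simp add: J_def)
  have "1 \<in> J" using assms ok by (auto simp: J_def sh_params_ok_def)
  define i where "i = Max J"
  have "i \<in> J" using \<open>finite J\<close> \<open>1 \<in> J\<close> unfolding i_def by (intro Max_in) auto
  have "Suc i \<notin> J" using Max_ge[OF \<open>finite J\<close>, of "Suc i"] by (auto simp: i_def)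
  then have "has_type P s i"
    using \<open>i \<in> J\<close> assms by (auto simp: J_def has_type_def)
  then show ?thesis ..
qed

lemma item_type_props:
  assumes "0 < s" "s \<le> 1"
  shows "1 \<le> item_type P s" "item_type P s \<le> ntypes P" "s \<le> thr P (item_type P s)"
    "item_type P s < ntypes P \<Longrightarrow> thr P (Suc (item_type P s)) < s"
proof -
  have "has_type P s (item_type P s)"
    unfolding item_type_def using has_type_ex[OF assms] has_type_unique by (metis theI)
  then show "1 \<le> item_type P s" "item_type P s \<le> ntypes P" "s \<le> thr P (item_type P s)"
    "item_type P s < ntypes P \<Longrightarrow> thr P (Suc (item_type P s)) < s"
    using N_ge_1 by (auto simp: has_type_def)
qed

text \<open>With fraction 0 the floor is 0 and no counter lies below it. This matters because
  \<open>redfit\<close> is known to be positive only for types with a positive fraction.\<close>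

lemma colour_Red_imp_red_pos:
  assumes "colour_of P \<sigma> k = Red" "0 \<le> red P (item_type P (\<sigma> ! k))"
  shows "0 < red P (item_type P (\<sigma> ! k))"
proof (rule ccontr)
  assume "\<not> ?thesis"
  then have "red P (item_type P (\<sigma> ! k)) = 0" using assms(2) by simp
  then show False using assms(1) by (simp add: colour_of_def Let_def)
qed

section \<open>Change of the bins under one arrival\<close>

lemma bin_items_snoc:
  "bin_items A (\<sigma> @ [s]) b = bin_items A \<sigma> b \<union> (if A (\<sigma> @ [s]) = b then {length \<sigma>} else {})"
  by (auto simp: bin_items_def bin_of_def less_Suc_eq)

lemma bin_items_less: "k \<in> bin_items A \<sigma> b \<Longrightarrow> k < length \<sigma>"
  by (simp add: bin_items_def)

lemma typed_items_snoc:
  "typed_items P A (\<sigma> @ [s]) b i c = typed_items P A \<sigma> b i c \<union>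
     (if A (\<sigma> @ [s]) = b \<and> item_type P s = i \<and> colour_of P (\<sigma> @ [s]) (length \<sigma>) = c
      then {length \<sigma>} else {})"
  using bin_items_less[of _ \<sigma> b]
  by (auto simp: typed_items_def bin_items_snoc nth_append colour_of_append)

lemma card_typed_items_snoc:
  "card (typed_items P A (\<sigma> @ [s]) b i c) = card (typed_items P A \<sigma> b i c) +
     (if A (\<sigma> @ [s]) = b \<and> item_type P s = i \<and> colour_of P (\<sigma> @ [s]) (length \<sigma>) = c
      then 1 else 0)"
proof -
  have "length \<sigma> \<notin> typed_items P A \<sigma> b i c"
    by (auto simp: typed_items_def dest: bin_items_less)
  then show ?thesis by (simp add: typed_items_snoc)
qed

text \<open>The smallest index in a bin is that of the item that opened it; later arrivals have
  larger indices.\<close>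

lemma pure_blue_snoc:
  assumes "bin_items A \<sigma> b \<noteq> {}"
  shows "pure_blue P A (\<sigma> @ [s]) b = pure_blue P A \<sigma> b"
proof -
  let ?m = "Min (bin_items A \<sigma> b)"
  have m: "?m \<in> bin_items A \<sigma> b" using assms by (intro Min_in) auto
  then have "?m < length \<sigma>" by (rule bin_items_less)
  have "Min (bin_items A (\<sigma> @ [s]) b) = ?m"
    using assms \<open>?m < length \<sigma>\<close> by (auto simp: bin_items_snoc Min_insert)
  then show ?thesis
    using assms \<open>?m < length \<sigma>\<close>
    by (auto simp: pure_blue_def Let_def nth_append colour_of_append bin_items_snoc)
qed

lemma unmixed_snoc_other:
  assumes "A (\<sigma> @ [s]) \<noteq> b"
  shows "unmixed P A (\<sigma> @ [s]) b j c = unmixed P A \<sigma> b j c"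
  using assms pure_blue_snoc[of \<sigma> b s]
  by (auto simp: unmixed_def bin_items_snoc typed_items_snoc)

lemma sh_rule_snoc: "bp_input (\<sigma> @ [s]) \<Longrightarrow> sh_rule P A \<sigma> s (A (\<sigma> @ [s]))"
  using sh by (simp add: super_harmonic_iff)

text \<open>The invariant that yields capacity 1 for bins with types below \<open>ntypes P\<close>:
  the caps bound the two colours separately, and the last clause, established when the bin becomes
  mixed, bounds them jointly.\<close>

definition coloured_bin :: "real list \<Rightarrow> nat \<Rightarrow> bool" where
  "coloured_bin \<sigma> b \<longleftrightarrow>
     (\<forall>k\<in>bin_items A \<sigma> b. item_type P (\<sigma> ! k) < ntypes P) \<and>
     (\<forall>k\<in>bin_items A \<sigma> b. \<forall>l\<in>bin_items A \<sigma> b.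
        colour_of P \<sigma> k = colour_of P \<sigma> l \<longrightarrow> item_type P (\<sigma> ! k) = item_type P (\<sigma> ! l)) \<and>
     (\<forall>i c. card (typed_items P A \<sigma> b i c) \<le> cfit P c i) \<and>
     (\<forall>k\<in>bin_items A \<sigma> b. \<forall>l\<in>bin_items A \<sigma> b.
        colour_of P \<sigma> k = Blue \<longrightarrow> colour_of P \<sigma> l = Red \<longrightarrow>
        needs P (item_type P (\<sigma> ! l)) \<le> leaves P (item_type P (\<sigma> ! k)))"

lemma coloured_bin_type_less:
  "coloured_bin \<sigma> b \<Longrightarrow> k \<in> bin_items A \<sigma> b \<Longrightarrow> item_type P (\<sigma> ! k) < ntypes P"
  unfolding coloured_bin_def by blast

lemma coloured_bin_same_type:
  "coloured_bin \<sigma> b \<Longrightarrow> k \<in> bin_items A \<sigma> b \<Longrightarrow> l \<in> bin_items A \<sigma> b \<Longrightarrow>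
   colour_of P \<sigma> k = colour_of P \<sigma> l \<Longrightarrow> item_type P (\<sigma> ! k) = item_type P (\<sigma> ! l)"
  unfolding coloured_bin_def by blast

lemma coloured_bin_card_le: "coloured_bin \<sigma> b \<Longrightarrow> card (typed_items P A \<sigma> b i c) \<le> cfit P c i"
  unfolding coloured_bin_def by blast

lemma coloured_bin_needs_leaves:
  "coloured_bin \<sigma> b \<Longrightarrow> k \<in> bin_items A \<sigma> b \<Longrightarrow> l \<in> bin_items A \<sigma> b \<Longrightarrow>
   colour_of P \<sigma> k = Blue \<Longrightarrow> colour_of P \<sigma> l = Red \<Longrightarrow>
   needs P (item_type P (\<sigma> ! l)) \<le> leaves P (item_type P (\<sigma> ! k))"
  unfolding coloured_bin_def by blast

definition sand_bin :: "real list \<Rightarrow> nat \<Rightarrow> bool" where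
  "sand_bin \<sigma> b \<longleftrightarrow> (\<forall>k\<in>bin_items A \<sigma> b. item_type P (\<sigma> ! k) = ntypes P) \<and> level A \<sigma> b \<le> 1"

lemma level_snoc:
  "level A (\<sigma> @ [s]) b = level A \<sigma> b + (if A (\<sigma> @ [s]) = b then s else 0)"
proof -
  have "(\<Sum>k\<in>bin_items A \<sigma> b. (\<sigma> @ [s]) ! k) = (\<Sum>k\<in>bin_items A \<sigma> b. \<sigma> ! k)"
    by (intro sum.cong) (auto simp: nth_append dest: bin_items_less)
  moreover have "length \<sigma> \<notin> bin_items A \<sigma> b" by (auto dest: bin_items_less)
  ultimately show ?thesis by (simp add: level_def bin_items_snoc)
qed

lemma coloured_bin_snoc_other:
  assumes "A (\<sigma> @ [s]) \<noteq> b"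
  shows "coloured_bin (\<sigma> @ [s]) b = coloured_bin \<sigma> b"
  using assms bin_items_less[of _ \<sigma> b]
  by (auto simp: coloured_bin_def bin_items_snoc typed_items_snoc nth_append colour_of_append)

lemma sand_bin_snoc_other:
  assumes "A (\<sigma> @ [s]) \<noteq> b"
  shows "sand_bin (\<sigma> @ [s]) b = sand_bin \<sigma> b"
  using assms bin_items_less[of _ \<sigma> b]
  by (auto simp: sand_bin_def bin_items_snoc level_snoc nth_append)

text \<open>Common induction step for the three ways of placing a coloured item: an open, a
  compatible and a new bin differ in how they supply the last three assumptions.\<close>

lemma coloured_bin_snoc:
  assumes "coloured_bin \<sigma> (A (\<sigma> @ [s]))" "item_type P s = i" "i < ntypes P"
    and "colour_of P (\<sigma> @ [s]) (length \<sigma>) = c"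
    and "\<And>k. k \<in> bin_items A \<sigma> (A (\<sigma> @ [s])) \<Longrightarrow> colour_of P \<sigma> k = c \<Longrightarrow> item_type P (\<sigma> ! k) = i"
    and "card (typed_items P A \<sigma> (A (\<sigma> @ [s])) i c) < cfit P c i"
    and "\<And>k. k \<in> bin_items A \<sigma> (A (\<sigma> @ [s])) \<Longrightarrow> colour_of P \<sigma> k \<noteq> c \<Longrightarrow>
           (if c = Red then needs P i \<le> leaves P (item_type P (\<sigma> ! k))
            else needs P (item_type P (\<sigma> ! k)) \<le> leaves P i)"
  shows "coloured_bin (\<sigma> @ [s]) (A (\<sigma> @ [s]))"
proof -
  let ?b = "A (\<sigma> @ [s])" and ?\<sigma> = "\<sigma> @ [s]"
  have old: "?\<sigma> ! k = \<sigma> ! k" "colour_of P ?\<sigma> k = colour_of P \<sigma> k" if "k \<in> bin_items A \<sigma> ?b" for k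
    using bin_items_less[OF that] by (auto simp: nth_append colour_of_append)
  have new: "?\<sigma> ! length \<sigma> = s" by simp
  have items: "bin_items A ?\<sigma> ?b = insert (length \<sigma>) (bin_items A \<sigma> ?b)"
    by (simp add: bin_items_snoc)
  have "card (typed_items P A ?\<sigma> ?b i' c') \<le> cfit P c' i'" for i' c'
  proof -
    have "card (typed_items P A \<sigma> ?b i' c') \<le> cfit P c' i'"
      using assms(1) by (rule coloured_bin_card_le)
    then show ?thesis using assms(2,4,6) by (auto simp: card_typed_items_snoc)
  qed
  moreover have "\<forall>k\<in>bin_items A ?\<sigma> ?b. item_type P (?\<sigma> ! k) < ntypes P"
  proof -
    note coloured_bin_type_less[OF assms(1)]
    with assms(2,3) old new show ?thesis unfolding items by simp
  qed
  moreover have "item_type P (?\<sigma> ! k) = item_type P (?\<sigma> ! l)"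
    if "k \<in> bin_items A ?\<sigma> ?b" "l \<in> bin_items A ?\<sigma> ?b" "colour_of P ?\<sigma> k = colour_of P ?\<sigma> l" for k l
  proof -
    have "item_type P (\<sigma> ! k) = item_type P (\<sigma> ! l)"
      if "k \<in> bin_items A \<sigma> ?b" "l \<in> bin_items A \<sigma> ?b" "colour_of P \<sigma> k = colour_of P \<sigma> l"
      using assms(1) that by (rule coloured_bin_same_type)
    with that old[of k] old[of l] new assms(2,4) assms(5)[of k] assms(5)[of l] show ?thesis
      unfolding items by (elim insertE) simp_all
  qed
  moreover have "needs P (item_type P (?\<sigma> ! l)) \<le> leaves P (item_type P (?\<sigma> ! k))"
    if "k \<in> bin_items A ?\<sigma> ?b" "l \<in> bin_items A ?\<sigma> ?b"
      "colour_of P ?\<sigma> k = Blue" "colour_of P ?\<sigma> l = Red" for k l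
  proof -
    have "needs P (item_type P (\<sigma> ! l)) \<le> leaves P (item_type P (\<sigma> ! k))"
      if "k \<in> bin_items A \<sigma> ?b" "l \<in> bin_items A \<sigma> ?b"
        "colour_of P \<sigma> k = Blue" "colour_of P \<sigma> l = Red"
      using assms(1) that by (rule coloured_bin_needs_leaves)
    with that old[of k] old[of l] new assms(2,4) assms(7)[of k] assms(7)[of l] show ?thesis
      unfolding items by (elim insertE) auto
  qed
  ultimately show ?thesis unfolding coloured_bin_def by blast
qed

lemma bluefit_pos:
  assumes "1 \<le> i" "i \<le> ntypes P"
  shows "1 \<le> bluefit P i"
proof -
  have "1 \<le> 1 / thr P i" using thr_pos[OF assms] thr_le_1[OF assms] by simp
  then have "1 \<le> \<lfloor>1 / thr P i\<rfloor>" by simp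
  then show ?thesis unfolding bluefit_def by linarith
qed

lemma bp_input_nth: "bp_input \<sigma> \<Longrightarrow> k < length \<sigma> \<Longrightarrow> 0 < \<sigma> ! k \<and> \<sigma> ! k \<le> 1"
  by (simp add: bp_input_def)

lemma bp_input_snocD: "bp_input (\<sigma> @ [s]) \<Longrightarrow> bp_input \<sigma> \<and> 0 < s \<and> s \<le> 1"
  by (simp add: bp_input_def)

lemma cfit_pos:
  assumes "bp_input \<sigma>" "k < length \<sigma>"
  shows "1 \<le> cfit P (colour_of P \<sigma> k) (item_type P (\<sigma> ! k))"
proof -
  let ?i = "item_type P (\<sigma> ! k)"
  have "1 \<le> ?i" "?i \<le> ntypes P" using item_type_props bp_input_nth[OF assms] by auto
  with bluefit_pos red_props[of ?i] colour_Red_imp_red_pos[of \<sigma> k] show ?thesis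
    by (cases "colour_of P \<sigma> k") (auto simp: cfit_def)
qed

lemma coloured_or_sand: "bp_input \<sigma> \<Longrightarrow> coloured_bin \<sigma> b \<or> sand_bin \<sigma> b"
proof (induction \<sigma> arbitrary: b rule: rev_induct)
  case Nil
  then show ?case by (simp add: sand_bin_def bin_items_def level_def)
next
  case (snoc s \<sigma>)
  define b0 where "b0 = A (\<sigma> @ [s])"
  define i where "i = item_type P s"
  define c where "c = colour_of P (\<sigma> @ [s]) (length \<sigma>)"
  have inp: "bp_input \<sigma>" "0 < s" "s \<le> 1" using bp_input_snocD[OF snoc.prems] by auto
  note IH = snoc.IH[OF inp(1)]
  have rule: "sh_rule P A \<sigma> s b0" using sh_rule_snoc[OF snoc.prems] by (simp add: b0_def)
  have "coloured_bin (\<sigma> @ [s]) b0 \<or> sand_bin (\<sigma> @ [s]) b0"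
  proof (cases "i = ntypes P")
    case True
    let ?T = "{k. k < length \<sigma> \<and> item_type P (\<sigma> ! k) = ntypes P}"
    have "next_fit_rule P A \<sigma> s b0" using rule True by (simp add: sh_rule_def i_def)
    then consider "?T \<noteq> {}" "level A \<sigma> b0 + s \<le> 1" "b0 = bin_of A \<sigma> (Max ?T)" | "new_bin A \<sigma> b0"
      unfolding next_fit_rule_def Let_def by (auto split: if_splits)
    then have "sand_bin (\<sigma> @ [s]) b0"
    proof cases
      case 1
      \<comment> \<open>The current bin already holds a sand item and so is not a coloured bin,
        which leaves only \<open>sand_bin\<close> in the induction hypothesis.\<close>
      obtain m where "m \<in> ?T" "b0 = bin_of A \<sigma> m"
        using Max_in[OF _ 1(1)] 1(3) by fastforce
      then have "m \<in> bin_items A \<sigma> b0" "\<not> item_type P (\<sigma> ! m) < ntypes P"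
        by (auto simp: bin_items_def)
      then have "\<not> coloured_bin \<sigma> b0" using coloured_bin_type_less by blast
      then have "sand_bin \<sigma> b0" using IH by blast
      moreover have "(\<sigma> @ [s]) ! k = \<sigma> ! k" if "k \<in> bin_items A \<sigma> b0" for k
        using bin_items_less[OF that] by (simp add: nth_append)
      ultimately show ?thesis using 1(2) True
        by (simp add: sand_bin_def bin_items_snoc level_snoc b0_def[symmetric] i_def)
    next
      case 2
      then show ?thesis using True inp
        by (simp add: sand_bin_def bin_items_snoc level_snoc b0_def[symmetric] i_def new_bin_def level_def)
    qed
    then show ?thesis ..
  next
    case False
    then have "i < ntypes P" using item_type_props(2)[OF inp(2,3)] by (simp add: i_def)
    \<comment> \<open>In a new or a compatible bin the arrival is the first item of colour
      \<open>c\<close>, and a positive cap is all the room it requires.\<close>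
    have cf: "1 \<le> cfit P c i"
      using cfit_pos[OF snoc.prems, of "length \<sigma>"] by (simp add: c_def i_def)
    have "coloured_rule P A \<sigma> i c b0"
      using rule False by (simp add: sh_rule_def i_def c_def)
    then consider "open_bin P A \<sigma> b0 i c" | "compatible P A \<sigma> b0 i c" | "new_bin A \<sigma> b0"
      by (auto simp: coloured_rule_def split: if_splits)
    then have "coloured_bin (\<sigma> @ [s]) b0"
    proof cases
      case 1
      then have "typed_items P A \<sigma> b0 i c \<noteq> {}" by (auto simp: open_bin_def)
      then obtain k where k: "k \<in> typed_items P A \<sigma> b0 i c" by blast
      then have k': "k \<in> bin_items A \<sigma> b0" "item_type P (\<sigma> ! k) = i" "colour_of P \<sigma> k = c"
        by (auto simp: typed_items_def)
      then have "\<not> sand_bin \<sigma> b0" using \<open>i < ntypes P\<close> by (auto simp: sand_bin_def)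
      then have cb: "coloured_bin \<sigma> b0" using IH by blast
      have same: "item_type P (\<sigma> ! l) = i" if "l \<in> bin_items A \<sigma> b0" "colour_of P \<sigma> l = c" for l
        using coloured_bin_same_type[OF cb that(1) k'(1)] that k' by simp
      have "if c = Red then needs P i \<le> leaves P (item_type P (\<sigma> ! l))
            else needs P (item_type P (\<sigma> ! l)) \<le> leaves P i"
        if "l \<in> bin_items A \<sigma> b0" "colour_of P \<sigma> l \<noteq> c" for l
        using coloured_bin_needs_leaves[OF cb k'(1) that(1)]
          coloured_bin_needs_leaves[OF cb that(1) k'(1)] that k'
        by (cases c; cases "colour_of P \<sigma> l") simp_all
      note compat = this
      show ?thesis
        unfolding b0_def
        by (rule coloured_bin_snoc[where c = c and i = i])
          (use cb same compat 1 \<open>i < ntypes P\<close> in \<open>auto simp: c_def[symmetric] i_def[symmetric] open_bin_def b0_def[symmetric]\<close>)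
    next
      case 2
      then obtain j c' where j: "unmixed P A \<sigma> b0 j c'" "c' \<noteq> c"
          "if c = Red then needs P i \<le> leaves P j else needs P j \<le> leaves P i"
        by (cases c) (auto simp: compatible_def)
      then have *: "item_type P (\<sigma> ! l) = j \<and> colour_of P \<sigma> l = c'" if "l \<in> bin_items A \<sigma> b0" for l
        using that by (auto simp: unmixed_def typed_items_def)
      have "\<not> sand_bin \<sigma> b0" using j * by (auto simp: sand_bin_def unmixed_def)
      then have cb: "coloured_bin \<sigma> b0" using IH by blast
      have "typed_items P A \<sigma> b0 i c = {}" using * j(2) by (auto simp: typed_items_def)
      then have "card (typed_items P A \<sigma> b0 i c) < cfit P c i" using cf by simp
      note fits = this
      show ?thesis
        unfolding b0_def
        by (rule coloured_bin_snoc[where c = c and i = i])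
          (use cb * j fits \<open>i < ntypes P\<close> in \<open>auto simp: c_def[symmetric] i_def[symmetric] b0_def[symmetric]\<close>)
    next
      case 3
      then have e: "bin_items A \<sigma> b0 = {}" by (simp add: new_bin_def)
      then have e': "typed_items P A \<sigma> b0 i c = {}" for i c by (simp add: typed_items_def)
      have cb: "coloured_bin \<sigma> b0" by (simp add: coloured_bin_def e e')
      show ?thesis
        unfolding b0_def
        by (rule coloured_bin_snoc[where c = c and i = i])
          (use cb e e'[of i c] cf \<open>i < ntypes P\<close> in \<open>auto simp: c_def[symmetric] i_def[symmetric] b0_def[symmetric]\<close>)
    qed
    then show ?thesis ..
  qed
  then show ?case
    using IH[of b] coloured_bin_snoc_other sand_bin_snoc_other b0_def by metis
qed

section \<open>Capacity of the bins\<close>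

lemma coloured_sum_le:
  assumes "bp_input \<sigma>" "coloured_bin \<sigma> b" "k0 \<in> bin_items A \<sigma> b"
  shows "(\<Sum>k | k \<in> bin_items A \<sigma> b \<and> colour_of P \<sigma> k = colour_of P \<sigma> k0. \<sigma> ! k)
    \<le> real (cfit P (colour_of P \<sigma> k0) (item_type P (\<sigma> ! k0))) * thr P (item_type P (\<sigma> ! k0))"
proof -
  let ?c = "colour_of P \<sigma> k0" and ?i = "item_type P (\<sigma> ! k0)"
  let ?B = "{k \<in> bin_items A \<sigma> b. colour_of P \<sigma> k = ?c}"
  have B: "?B = typed_items P A \<sigma> b ?i ?c"
  proof -
    have "item_type P (\<sigma> ! k) = ?i" if "k \<in> ?B" for k
      using coloured_bin_same_type[OF assms(2) _ assms(3)] that by blast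
    then show ?thesis by (auto simp: typed_items_def)
  qed
  have size: "0 < \<sigma> ! k" "\<sigma> ! k \<le> 1" if "k \<in> bin_items A \<sigma> b" for k
    using bp_input_nth[OF assms(1) bin_items_less[OF that]] by auto
  have "(\<Sum>k\<in>?B. \<sigma> ! k) \<le> (\<Sum>k\<in>?B. thr P ?i)"
  proof (rule sum_mono)
    fix k assume k: "k \<in> ?B"
    then have "item_type P (\<sigma> ! k) = ?i" by (simp add: B typed_items_def)
    then show "\<sigma> ! k \<le> thr P ?i" using item_type_props(3)[OF size, of k] k by simp
  qed
  also have "\<dots> = real (card ?B) * thr P ?i" by simp
  also have "\<dots> \<le> real (cfit P ?c ?i) * thr P ?i"
  proof (rule mult_right_mono)
    show "real (card ?B) \<le> real (cfit P ?c ?i)"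
      unfolding B using coloured_bin_card_le[OF assms(2)] by simp
    show "0 \<le> thr P ?i"
      using item_type_props(1,2)[OF size[OF assms(3)]] thr_pos[of ?i] by simp
  qed
  finally show ?thesis by simp
qed

lemma bluefit_thr_le_1:
  assumes "1 \<le> i" "i \<le> ntypes P"
  shows "real (bluefit P i) * thr P i \<le> 1"
proof -
  have pos: "0 < thr P i" using thr_pos[OF assms] .
  then have "real (bluefit P i) \<le> 1 / thr P i" by (simp add: bluefit_def)
  with pos show ?thesis by (simp add: field_simps)
qed

lemma redfit_thr_le:
  assumes "1 \<le> i" "i \<le> ntypes P" "0 < red P i"
  shows "real (redfit P i) * thr P i \<le> redspace P (needs P i)"
proof -
  have pos: "0 < thr P i" using thr_pos[OF assms(1,2)] .
  have "1 \<le> needs P i" "needs P i \<le> nspaces P"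
    using red_props(4,5)[OF assms(1,2)] assms(3) by auto
  then have "0 < redspace P (needs P i)" using ok by (simp add: sh_params_ok_def)
  with pos have "real (redfit P i) \<le> redspace P (needs P i) / thr P i"
    by (simp add: redfit_def)
  with pos show ?thesis by (simp add: field_simps)
qed

lemma redspace_bounds: "1 \<le> k \<Longrightarrow> k \<le> nspaces P \<Longrightarrow> 0 < redspace P k \<and> redspace P k < 1"
  using ok by (simp add: sh_params_ok_def)

lemma redspace_mono:
  assumes "1 \<le> k" "k \<le> l" "l \<le> nspaces P"
  shows "redspace P k \<le> redspace P l"
  using assms(2,3)
proof (induction l rule: dec_induct)
  case (step n)
  then have "redspace P n \<le> redspace P (Suc n)"
    using ok assms(1) by (simp add: sh_params_ok_def)
  with step show ?case by simp
qed simp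

text \<open>The blue items fill at most \<open>bluefit\<close> times the threshold of their type,
  the red ones at most the space that their type needs. In a mixed bin this space is at most the one
  left by the blue type, hence at most 1 minus the blue bound.\<close>

lemma level_le_1:
  assumes "bp_input \<sigma>"
  shows "level A \<sigma> b \<le> 1"
proof (cases "sand_bin \<sigma> b")
  case True
  then show ?thesis by (simp add: sand_bin_def)
next
  case False
  then have cb: "coloured_bin \<sigma> b" using coloured_or_sand[OF assms] by blast
  let ?B = "\<lambda>c. {k \<in> bin_items A \<sigma> b. colour_of P \<sigma> k = c}"
  have "level A \<sigma> b = (\<Sum>k\<in>?B Blue \<union> ?B Red. \<sigma> ! k)"
    unfolding level_def by (rule sum.cong) (auto intro: colour.exhaust)
  also have "\<dots> = (\<Sum>k\<in>?B Blue. \<sigma> ! k) + (\<Sum>k\<in>?B Red. \<sigma> ! k)"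
    by (rule sum.union_disjoint) auto
  finally have split: "level A \<sigma> b = (\<Sum>k\<in>?B Blue. \<sigma> ! k) + (\<Sum>k\<in>?B Red. \<sigma> ! k)" .
  have type: "1 \<le> item_type P (\<sigma> ! k)" "item_type P (\<sigma> ! k) \<le> ntypes P" if "k \<in> bin_items A \<sigma> b" for k
    using item_type_props(1,2) bp_input_nth[OF assms bin_items_less[OF that]] by auto
  have blue: "(\<Sum>k\<in>?B Blue. \<sigma> ! k) \<le> real (bluefit P (item_type P (\<sigma> ! k))) * thr P (item_type P (\<sigma> ! k))"
    if "k \<in> ?B Blue" for k
    using coloured_sum_le[OF assms cb, of k] that by (simp add: cfit_def)
  have red: "(\<Sum>k\<in>?B Red. \<sigma> ! k) \<le> redspace P (needs P (item_type P (\<sigma> ! k)))"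
    and red_pos: "0 < red P (item_type P (\<sigma> ! k))" if "k \<in> ?B Red" for k
  proof -
    show *: "0 < red P (item_type P (\<sigma> ! k))"
      using colour_Red_imp_red_pos[of \<sigma> k] type[of k] red_props(1) that by simp
    show "(\<Sum>k\<in>?B Red. \<sigma> ! k) \<le> redspace P (needs P (item_type P (\<sigma> ! k)))"
      using coloured_sum_le[OF assms cb, of k] redfit_thr_le[OF type *] that
      by (simp add: cfit_def)
  qed
  show ?thesis
  proof (cases "?B Blue = {}")
    case True
    then have B0: "(\<Sum>k\<in>?B Blue. \<sigma> ! k) = 0" by (simp only: sum.empty)
    show ?thesis
    proof (cases "?B Red = {}")
      case True
      then have "(\<Sum>k\<in>?B Red. \<sigma> ! k) = 0" by (simp only: sum.empty)
      with B0 split show ?thesis by simp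
    next
      case False
      then obtain k where k: "k \<in> ?B Red" by blast
      let ?i = "item_type P (\<sigma> ! k)"
      have i: "1 \<le> ?i" "?i \<le> ntypes P" using type k by auto
      have "1 \<le> needs P ?i" "needs P ?i \<le> nspaces P"
        using red_pos[OF k] red_props(4,5)[OF i] by auto
      then show ?thesis using split B0 red[OF k] redspace_bounds[of "needs P ?i"] by simp
    qed
  next
    case False
    then obtain k where k: "k \<in> ?B Blue" by blast
    let ?i = "item_type P (\<sigma> ! k)"
    have i: "1 \<le> ?i" "?i \<le> ntypes P" using type k by auto
    show ?thesis
    proof (cases "?B Red = {}")
      case True
      then have "(\<Sum>k\<in>?B Red. \<sigma> ! k) = 0" by (simp only: sum.empty)
      with split blue[OF k] bluefit_thr_le_1[OF i] show ?thesis by simp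
    next
      case False
      then obtain l where l: "l \<in> ?B Red" by blast
      let ?j = "item_type P (\<sigma> ! l)"
      have j: "1 \<le> ?j" "?j \<le> ntypes P" using type l by auto
      have le: "needs P ?j \<le> leaves P ?i"
        using coloured_bin_needs_leaves[OF cb, of k l] k l by simp
      have "1 \<le> needs P ?j" using red_pos[OF l] red_props(5)[OF j] by simp
      then have "redspace P (needs P ?j) \<le> redspace P (leaves P ?i)"
        using redspace_mono[OF _ le] red_props(3)[OF i] by simp
      also have "\<dots> \<le> 1 - real (bluefit P ?i) * thr P ?i"
        using red_props(7)[OF i] le \<open>1 \<le> needs P ?j\<close> by simp
      finally show ?thesis using split blue[OF k] red[OF l] by simp
    qed
  qed
qed

section \<open>Open and unmixed bins\<close>

lemma open_bin_unique:
  "bp_input \<sigma> \<Longrightarrow> i < ntypes P \<Longrightarrow> open_bin P A \<sigma> b i c \<Longrightarrow> open_bin P A \<sigma> b' i c \<Longrightarrow> b = b'"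
proof (induction \<sigma> arbitrary: b b' i c rule: rev_induct)
  case Nil
  then show ?case by (simp add: open_bin_def typed_items_def bin_items_def)
next
  case (snoc s \<sigma>)
  have inp: "bp_input \<sigma>" using bp_input_snocD[OF snoc.prems(1)] by auto
  define b0 where "b0 = A (\<sigma> @ [s])"
  have same: "open_bin P A (\<sigma> @ [s]) b i c = open_bin P A \<sigma> b i c"
    if "\<not> (b = b0 \<and> item_type P s = i \<and> colour_of P (\<sigma> @ [s]) (length \<sigma>) = c)" for b
    using that by (auto simp: open_bin_def card_typed_items_snoc b0_def)
  show ?case
  proof (cases "item_type P s = i \<and> colour_of P (\<sigma> @ [s]) (length \<sigma>) = c")
    case False
    with same snoc.IH[OF inp] snoc.prems show ?thesis by blast
  next
    case True
    have "coloured_rule P A \<sigma> i c b0"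
      using sh_rule_snoc[OF snoc.prems(1)] True snoc.prems(2) by (simp add: sh_rule_def b0_def)
    \<comment> \<open>If an open bin exists, it is the only one and receives the item, so it is
      \<open>b0\<close>; if none exists, only \<open>b0\<close> can become open.\<close>
    then have "open_bin P A \<sigma> b0 i c \<or> (\<forall>b. \<not> open_bin P A \<sigma> b i c)"
      by (auto simp: coloured_rule_def split: if_splits)
    then have "b = b0" if "open_bin P A (\<sigma> @ [s]) b i c" for b
      using that same[of b] snoc.IH[OF inp snoc.prems(2)] by blast
    with snoc.prems show ?thesis by blast
  qed
qed

text \<open>A bin starts being unmixed only when it is opened, and a coloured item opens a bin only
  if no compatible one exists. Later arrivals in a bin that stays unmixed do not change its type or
  colour.\<close>

lemma unmixed_incompatible:
  "bp_input \<sigma> \<Longrightarrow> unmixed P A \<sigma> b i Blue \<Longrightarrow> unmixed P A \<sigma> b' j Red \<Longrightarrow> leaves P i < needs P j"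
proof (induction \<sigma> arbitrary: b b' i j rule: rev_induct)
  case Nil
  then show ?case by (simp add: unmixed_def bin_items_def)
next
  case (snoc s \<sigma>)
  have inp: "bp_input \<sigma>" "0 < s" "s \<le> 1" using bp_input_snocD[OF snoc.prems(1)] by auto
  define b0 where "b0 = A (\<sigma> @ [s])"
  define t where "t = item_type P s"
  define d where "d = colour_of P (\<sigma> @ [s]) (length \<sigma>)"
  have other: "unmixed P A (\<sigma> @ [s]) b l c = unmixed P A \<sigma> b l c" if "b \<noteq> b0" for b l c
    using unmixed_snoc_other that by (auto simp: b0_def)
  have "b \<noteq> b'"
  proof
    assume "b = b'"
    then obtain k where "k \<in> typed_items P A (\<sigma> @ [s]) b i Blue" "k \<in> typed_items P A (\<sigma> @ [s]) b j Red"
      using snoc.prems(2,3) unfolding unmixed_def by blast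
    then show False by (simp add: typed_items_def)
  qed
  have n0: "length \<sigma> \<in> bin_items A (\<sigma> @ [s]) b0" by (simp add: bin_items_snoc b0_def)
  have type: "l = t \<and> c = d \<and> l < ntypes P" if "unmixed P A (\<sigma> @ [s]) b0 l c" for l c
  proof -
    have "length \<sigma> \<in> typed_items P A (\<sigma> @ [s]) b0 l c" "l < ntypes P"
      using that n0 unfolding unmixed_def by blast+
    then show ?thesis by (simp add: typed_items_def t_def d_def)
  qed
  have old: "unmixed P A \<sigma> b0 l c" if "unmixed P A (\<sigma> @ [s]) b0 l c" "bin_items A \<sigma> b0 \<noteq> {}" for l c
  proof -
    have "bin_items A \<sigma> b0 = typed_items P A \<sigma> b0 l c"
    proof -
      have "k \<in> typed_items P A \<sigma> b0 l c" if k: "k \<in> bin_items A \<sigma> b0" for k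
      proof -
        have "k \<in> bin_items A (\<sigma> @ [s]) b0" using k by (simp add: bin_items_snoc)
        then have "k \<in> typed_items P A (\<sigma> @ [s]) b0 l c"
          using \<open>unmixed P A (\<sigma> @ [s]) b0 l c\<close> by (simp add: unmixed_def)
        then show ?thesis using bin_items_less[OF k] by (auto simp: typed_items_snoc split: if_splits)
      qed
      then show ?thesis by (auto simp: typed_items_def)
    qed
    then show ?thesis using that pure_blue_snoc[of \<sigma> b0 s] by (simp add: unmixed_def)
  qed
  have new: "coloured_rule P A \<sigma> t d b0" if "t \<noteq> ntypes P"
    using sh_rule_snoc[OF snoc.prems(1)] that by (simp add: sh_rule_def b0_def t_def d_def)
  have not_comp: "\<not> compatible P A \<sigma> b' t d"
    if "unmixed P A (\<sigma> @ [s]) b0 l c" "bin_items A \<sigma> b0 = {}" for b' l c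
  proof -
    \<comment> \<open>A bin that was empty before the arrival is neither open nor compatible, so the
      third branch of the rule was taken and no compatible bin existed.\<close>
    have "\<not> open_bin P A \<sigma> b0 t d" "\<not> compatible P A \<sigma> b0 t d"
      using that(2) by (auto simp: open_bin_def typed_items_def compatible_def unmixed_def split: colour.splits)
    then show ?thesis using new type[OF that(1)] by (auto simp: coloured_rule_def split: if_splits)
  qed
  consider "b \<noteq> b0" "b' \<noteq> b0" | "b = b0" "b' \<noteq> b0" | "b \<noteq> b0" "b' = b0"
    using \<open>b \<noteq> b'\<close> by blast
  then show ?case
  proof cases
    case 1
    then show ?thesis using other snoc.IH[OF inp(1)] snoc.prems by blast
  next
    case 2
    then have b': "unmixed P A \<sigma> b' j Red" using other snoc.prems by blast
    show ?thesis
    proof (cases "bin_items A \<sigma> b0 = {}")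
      case True
      have "\<not> compatible P A \<sigma> b' t d" using not_comp snoc.prems(2) 2 True by blast
      moreover have "i = t" "d = Blue" using type snoc.prems(2) 2 by auto
      ultimately show ?thesis using b' by (auto simp: compatible_def)
    next
      case False
      then show ?thesis using old snoc.prems(2) 2 b' snoc.IH[OF inp(1)] by blast
    qed
  next
    case 3
    then have b: "unmixed P A \<sigma> b i Blue" using other snoc.prems by blast
    show ?thesis
    proof (cases "bin_items A \<sigma> b0 = {}")
      case True
      have "\<not> compatible P A \<sigma> b t d" using not_comp snoc.prems(3) 3 True by blast
      moreover have "j = t" "d = Red" using type snoc.prems(3) 3 by auto
      ultimately show ?thesis using b by (auto simp: compatible_def)
    next
      case False
      then show ?thesis using old snoc.prems(3) 3 b snoc.IH[OF inp(1)] by blast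
    qed
  qed
qed

section \<open>Next Fit on sand\<close>

definition sand_items :: "real list \<Rightarrow> nat set" where
  "sand_items \<sigma> = {k. k < length \<sigma> \<and> item_type P (\<sigma> ! k) = ntypes P}"

definition sand_bins :: "real list \<Rightarrow> nat set" where
  "sand_bins \<sigma> = {b. bin_items A \<sigma> b \<noteq> {} \<and> (\<forall>k\<in>bin_items A \<sigma> b. item_type P (\<sigma> ! k) = ntypes P)}"

lemma sand_items_snoc:
  "sand_items (\<sigma> @ [s]) = sand_items \<sigma> \<union> (if item_type P s = ntypes P then {length \<sigma>} else {})"
  by (auto simp: sand_items_def nth_append less_Suc_eq)

lemma finite_sand_items [simp]: "finite (sand_items \<sigma>)"
  by (simp add: sand_items_def)

text \<open>Next Fit leaves its current bin only when an item of size at most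
  \<open>thr P (ntypes P)\<close> does not fit on top of the contents. The bin of the latest sand
  item is the current one, hence the exception.\<close>

lemma sand_bins_full:
  "bp_input \<sigma> \<Longrightarrow> b \<in> sand_bins \<sigma> \<Longrightarrow> b \<noteq> bin_of A \<sigma> (Max (sand_items \<sigma>)) \<Longrightarrow>
   1 - thr P (ntypes P) < level A \<sigma> b"
proof (induction \<sigma> arbitrary: b rule: rev_induct)
  case Nil
  then show ?case by (simp add: sand_bins_def bin_items_def)
next
  case (snoc s \<sigma>)
  have inp: "bp_input \<sigma>" "0 < s" "s \<le> 1" using bp_input_snocD[OF snoc.prems(1)] by auto
  define b0 where "b0 = A (\<sigma> @ [s])"
  let ?cur = "bin_of A \<sigma> (Max (sand_items \<sigma>))"
  have sb: "b \<in> sand_bins \<sigma>" if "b \<noteq> b0"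
  proof -
    have "bin_items A (\<sigma> @ [s]) b = bin_items A \<sigma> b" using that by (simp add: bin_items_snoc b0_def)
    moreover have "(\<sigma> @ [s]) ! k = \<sigma> ! k" if "k \<in> bin_items A \<sigma> b" for k
      using bin_items_less[OF that] by (simp add: nth_append)
    ultimately show ?thesis using snoc.prems(2) by (simp add: sand_bins_def)
  qed
  have nonempty: "sand_items \<sigma> \<noteq> {}" if "b \<in> sand_bins \<sigma>"
    using that bin_items_less by (fastforce simp: sand_bins_def sand_items_def)
  have lev: "level A (\<sigma> @ [s]) b = level A \<sigma> b" if "b \<noteq> b0"
    using that by (simp add: level_snoc b0_def)
  show ?case
  proof (cases "item_type P s = ntypes P")
    case True
    have "Max (sand_items (\<sigma> @ [s])) = length \<sigma>"
    proof (rule Max_eqI)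
      show "finite (sand_items (\<sigma> @ [s]))" by (rule finite_sand_items)
      show "length \<sigma> \<in> sand_items (\<sigma> @ [s])" using True by (simp add: sand_items_snoc)
      show "k \<le> length \<sigma>" if "k \<in> sand_items (\<sigma> @ [s])" for k
        using that by (simp add: sand_items_def)
    qed
    then have "b \<noteq> b0" using snoc.prems(3) by (simp add: bin_of_def b0_def)
    note sb = sb[OF this] and lev = lev[OF this]
    show ?thesis
    proof (cases "b = ?cur")
      case False
      then show ?thesis using snoc.IH[OF inp(1) sb] lev by simp
    next
      case cur: True
      have "next_fit_rule P A \<sigma> s b0"
        using sh_rule_snoc[OF snoc.prems(1)] True by (simp add: sh_rule_def b0_def)
      then have "\<not> level A \<sigma> b + s \<le> 1"
        using nonempty[OF sb] \<open>b \<noteq> b0\<close> cur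
        unfolding next_fit_rule_def Let_def sand_items_def[symmetric] by auto
      moreover have "s \<le> thr P (ntypes P)" using item_type_props(3)[OF inp(2,3)] True by simp
      ultimately show ?thesis using lev by simp
    qed
  next
    case False
    have "length \<sigma> \<notin> bin_items A (\<sigma> @ [s]) b" using snoc.prems(2) False by (auto simp: sand_bins_def)
    then have "b \<noteq> b0" by (auto simp: bin_items_snoc b0_def)
    note sb = sb[OF this] and lev = lev[OF this]
    have items: "sand_items (\<sigma> @ [s]) = sand_items \<sigma>" using False by (simp add: sand_items_snoc)
    have "Max (sand_items \<sigma>) \<in> sand_items \<sigma>" using nonempty[OF sb] by (intro Max_in) auto
    then have "Max (sand_items \<sigma>) < length \<sigma>" by (simp add: sand_items_def)
    then have "bin_of A (\<sigma> @ [s]) (Max (sand_items (\<sigma> @ [s]))) = ?cur" by (simp add: items bin_of_def)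
    then show ?thesis using snoc.IH[OF inp(1) sb] snoc.prems(3) lev by simp
  qed
qed

section \<open>Counting bins by weights\<close>

definition typed_bins :: "real list \<Rightarrow> nat \<Rightarrow> colour \<Rightarrow> nat set" where
  "typed_bins \<sigma> i c = {b. typed_items P A \<sigma> b i c \<noteq> {}}"

definition used_bins :: "real list \<Rightarrow> nat set" where
  "used_bins \<sigma> = {b. bin_items A \<sigma> b \<noteq> {}}"

lemma finite_used_bins [simp]: "finite (used_bins \<sigma>)"
  by (rule finite_subset[of _ "bin_of A \<sigma> ` {..<length \<sigma>}"]) (auto simp: used_bins_def bin_items_def)

lemma finite_typed_bins [simp]: "finite (typed_bins \<sigma> i c)"
  by (rule finite_subset[OF _ finite_used_bins[of \<sigma>]])
    (auto simp: used_bins_def typed_bins_def typed_items_def)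

lemma finite_sand_bins [simp]: "finite (sand_bins \<sigma>)"
  by (rule finite_subset[OF _ finite_used_bins[of \<sigma>]]) (auto simp: used_bins_def sand_bins_def)

text \<open>A bin with an item of this type and colour is either open or holds
  \<open>cfit P c i\<close> of them. At most one is open; crediting it with a full load gives the
  additive term.\<close>

lemma card_typed_bins_le:
  assumes "bp_input \<sigma>" "i < ntypes P"
  shows "card (typed_bins \<sigma> i c) * cfit P c i \<le>
    card {k. k < length \<sigma> \<and> item_type P (\<sigma> ! k) = i \<and> colour_of P \<sigma> k = c} + cfit P c i"
proof -
  let ?X = "typed_bins \<sigma> i c" and ?f = "cfit P c i"
  have "{k. k < length \<sigma> \<and> item_type P (\<sigma> ! k) = i \<and> colour_of P \<sigma> k = c} =
      (\<Union>b\<in>?X. typed_items P A \<sigma> b i c)"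
    by (auto simp: typed_bins_def typed_items_def bin_items_def)
  moreover have "card (\<Union>b\<in>?X. typed_items P A \<sigma> b i c) = (\<Sum>b\<in>?X. card (typed_items P A \<sigma> b i c))"
    by (rule card_UN_disjoint) (auto simp: typed_items_def bin_items_def)
  moreover have "card ?X * ?f \<le> (\<Sum>b\<in>?X. card (typed_items P A \<sigma> b i c) + (if open_bin P A \<sigma> b i c then ?f else 0))"
    by (rule sum_bounded_below[of ?X ?f, simplified])
      (auto simp: typed_bins_def open_bin_def not_less card_gt_0_iff)
  moreover have "(\<Sum>b\<in>?X. if open_bin P A \<sigma> b i c then ?f else 0) \<le> ?f"
  proof -
    have "(\<Sum>b\<in>?X. if open_bin P A \<sigma> b i c then ?f else 0) = card {b \<in> ?X. open_bin P A \<sigma> b i c} * ?f"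
      by (simp add: sum.If_cases Int_def)
    moreover have "card {b \<in> ?X. open_bin P A \<sigma> b i c} \<le> Suc 0"
      using open_bin_unique[OF assms] by (subst card_le_Suc0_iff_eq) auto
    ultimately show ?thesis by simp
  qed
  ultimately show ?thesis by (simp add: sum.distrib)
qed

text \<open>One unit of the additive 2 pays for the open bin, the other for rounding: the number of
  blue items exceeds the fraction \<open>1 - red P i\<close> of all items of the type by less than
  1, and \<open>bluefit P i\<close> is at least 1.\<close>

lemma card_blue_bins_le:
  assumes "bp_input \<sigma>" "1 \<le> i" "i < ntypes P"
  shows "real (card (typed_bins \<sigma> i Blue)) \<le>
    (1 - red P i) / bluefit P i * n_items P \<sigma> i (length \<sigma>) + 2"
proof -
  let ?n = "n_items P \<sigma> i (length \<sigma>)" and ?S = "\<lambda>c. {k. k < length \<sigma> \<and> item_type P (\<sigma> ! k) = i \<and> colour_of P \<sigma> k = c}"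
  have red: "0 \<le> red P i" "red P i \<le> 1" using red_props[of i] assms by auto
  have bf: "1 \<le> bluefit P i" using bluefit_pos assms by simp
  have "{k. k < length \<sigma> \<and> item_type P (\<sigma> ! k) = i} = ?S Blue \<union> ?S Red"
  proof -
    have "colour_of P \<sigma> k = Blue \<or> colour_of P \<sigma> k = Red" for k
      by (cases "colour_of P \<sigma> k") simp_all
    then show ?thesis by blast
  qed
  moreover have "card (?S Blue \<union> ?S Red) = card (?S Blue) + card (?S Red)"
    by (rule card_Un_disjoint) auto
  ultimately have "?n = card (?S Blue) + card (?S Red)"
    unfolding n_items_def by metis
  moreover have "int (card (?S Red)) = \<lfloor>red P i * real ?n\<rfloor>"
    using card_red_items n_red_eq_floor[OF red] by simp
  ultimately have "real (card (?S Blue)) \<le> (1 - red P i) * ?n + 1"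
    by (simp add: algebra_simps) linarith
  moreover have "real (card (typed_bins \<sigma> i Blue)) * bluefit P i \<le> card (?S Blue) + bluefit P i"
  proof -
    have "card (typed_bins \<sigma> i Blue) * bluefit P i \<le> card (?S Blue) + bluefit P i"
      using card_typed_bins_le[OF assms(1,3), of Blue] by (simp add: cfit_def)
    then have "real (card (typed_bins \<sigma> i Blue) * bluefit P i) \<le> real (card (?S Blue) + bluefit P i)"
      by (simp only: of_nat_le_iff)
    then show ?thesis by simp
  qed
  ultimately have "real (card (typed_bins \<sigma> i Blue)) * bluefit P i \<le> (1 - red P i) * ?n + 2 * bluefit P i"
    using bf by simp
  with bf show ?thesis by (simp add: field_simps)
qed

lemma card_red_bins_le:
  assumes "bp_input \<sigma>" "1 \<le> i" "i < ntypes P"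
  shows "real (card (typed_bins \<sigma> i Red)) \<le> red P i / redfit P i * n_items P \<sigma> i (length \<sigma>) + 1"
proof -
  let ?n = "n_items P \<sigma> i (length \<sigma>)" and ?S = "{k. k < length \<sigma> \<and> item_type P (\<sigma> ! k) = i \<and> colour_of P \<sigma> k = Red}"
  have red: "0 \<le> red P i" "red P i \<le> 1" using red_props[of i] assms by auto
  show ?thesis
  proof (cases "red P i = 0")
    case True
    then have "typed_items P A \<sigma> b i Red = {}" for b
      by (fastforce simp: typed_items_def dest: colour_Red_imp_red_pos)
    then show ?thesis using True by (simp add: typed_bins_def)
  next
    case False
    then have rf: "1 \<le> redfit P i" using red_props(6)[of i] assms red by simp
    have "card ?S = n_red P \<sigma> i (length \<sigma>)" by (rule card_red_items)
    moreover have "real_of_int (int (n_red P \<sigma> i (length \<sigma>))) \<le> red P i * real ?n"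
      unfolding n_red_eq_floor[OF red] by (rule of_int_floor_le)
    ultimately have "real (card ?S) \<le> red P i * ?n" by simp
    moreover have "real (card (typed_bins \<sigma> i Red)) * redfit P i \<le> card (?S) + redfit P i"
    proof -
      have "card (typed_bins \<sigma> i Red) * redfit P i \<le> card (?S) + redfit P i"
        using card_typed_bins_le[OF assms(1,3), of Red] by (simp add: cfit_def)
      then have "real (card (typed_bins \<sigma> i Red) * redfit P i) \<le> real (card (?S) + redfit P i)"
        by (simp only: of_nat_le_iff)
      then show ?thesis by simp
    qed
    ultimately have "real (card (typed_bins \<sigma> i Red)) * redfit P i \<le> red P i * ?n + redfit P i"
      by simp
    with rf show ?thesis by (simp add: field_simps)
  qed
qed

lemma card_sand_bins_le:
  assumes "bp_input \<sigma>" "thr P (ntypes P) < 1"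
  shows "real (card (sand_bins \<sigma>)) \<le> (\<Sum>k\<in>sand_items \<sigma>. \<sigma> ! k) / (1 - thr P (ntypes P)) + 1"
proof -
  let ?cur = "bin_of A \<sigma> (Max (sand_items \<sigma>))" and ?d = "1 - thr P (ntypes P)"
  let ?X = "sand_bins \<sigma> - {?cur}"
  have "real (card ?X) * ?d \<le> (\<Sum>b\<in>?X. level A \<sigma> b)"
    by (rule sum_bounded_below) (use sand_bins_full[OF assms(1)] in \<open>force intro: less_imp_le\<close>)
  also have "\<dots> = (\<Sum>k\<in>(\<Union>b\<in>?X. bin_items A \<sigma> b). \<sigma> ! k)"
    unfolding level_def by (rule sum.UNION_disjoint[symmetric]) (auto simp: bin_items_def)
  also have "\<dots> \<le> (\<Sum>k\<in>sand_items \<sigma>. \<sigma> ! k)"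
  proof (rule sum_mono2)
    show "(\<Union>b\<in>?X. bin_items A \<sigma> b) \<subseteq> sand_items \<sigma>"
      by (auto simp: sand_bins_def sand_items_def dest: bin_items_less)
    show "0 \<le> \<sigma> ! k" if "k \<in> sand_items \<sigma> - (\<Union>b\<in>?X. bin_items A \<sigma> b)" for k
      using that bp_input_nth[OF assms(1), of k] by (auto simp: sand_items_def)
  qed simp
  finally have "real (card ?X) \<le> (\<Sum>k\<in>sand_items \<sigma>. \<sigma> ! k) / ?d"
    using assms(2) by (simp add: field_simps)
  moreover have "card (sand_bins \<sigma>) \<le> card ?X + 1"
    by (auto simp: card_Diff_singleton_if)
  ultimately show ?thesis by linarith
qed

section \<open>Counting the bins in two ways\<close>

lemma used_bin_cases:
  assumes "bp_input \<sigma>" "b \<in> used_bins \<sigma>" "b \<notin> sand_bins \<sigma>"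
  obtains (mixed) i j where "1 \<le> i" "i < ntypes P" "b \<in> typed_bins \<sigma> i Blue"
      "1 \<le> j" "j < ntypes P" "b \<in> typed_bins \<sigma> j Red"
    | (pure) i where "1 \<le> i" "i < ntypes P" "b \<in> typed_bins \<sigma> i Blue" "leaves P i = 0"
    | (blue) i where "1 \<le> i" "i < ntypes P" "b \<in> typed_bins \<sigma> i Blue" "unmixed P A \<sigma> b i Blue"
    | (red) j where "1 \<le> j" "j < ntypes P" "b \<in> typed_bins \<sigma> j Red" "unmixed P A \<sigma> b j Red"
proof -
  have cb: "coloured_bin \<sigma> b"
    using coloured_or_sand[OF assms(1), of b] assms(2,3)
    by (auto simp: used_bins_def sand_bins_def sand_bin_def)
  have type: "1 \<le> item_type P (\<sigma> ! k)" "item_type P (\<sigma> ! k) < ntypes P"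
    "b \<in> typed_bins \<sigma> (item_type P (\<sigma> ! k)) (colour_of P \<sigma> k)" if "k \<in> bin_items A \<sigma> b" for k
    using coloured_bin_type_less[OF cb that] that
      item_type_props(1) bp_input_nth[OF assms(1) bin_items_less[OF that]]
    by (auto simp: typed_bins_def typed_items_def)
  obtain k where k: "k \<in> bin_items A \<sigma> b" using assms(2) by (auto simp: used_bins_def)
  have single: "bin_items A \<sigma> b = typed_items P A \<sigma> b (item_type P (\<sigma> ! k)) (colour_of P \<sigma> k)"
    if "\<And>l. l \<in> bin_items A \<sigma> b \<Longrightarrow> colour_of P \<sigma> l = colour_of P \<sigma> k"
    using coloured_bin_same_type[OF cb _ k] that unfolding typed_items_def by blast
  show thesis
  proof (cases "\<exists>l\<in>bin_items A \<sigma> b. colour_of P \<sigma> l \<noteq> colour_of P \<sigma> k")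
    case True
    then obtain l where l: "l \<in> bin_items A \<sigma> b" "colour_of P \<sigma> l \<noteq> colour_of P \<sigma> k" by blast
    show thesis
      using type[OF k] type[OF l(1)] l(2) mixed
      by (cases "colour_of P \<sigma> k"; cases "colour_of P \<sigma> l") auto
  next
    case False
    then have s: "bin_items A \<sigma> b = typed_items P A \<sigma> b (item_type P (\<sigma> ! k)) (colour_of P \<sigma> k)"
      using single by blast
    \<comment> \<open>All items share one type and colour, so the opening item, which decides
      between pure blue and unmixed, has the type and colour of \<open>k\<close>.\<close>
    let ?m = "Min (bin_items A \<sigma> b)"
    have "?m \<in> bin_items A \<sigma> b" using k by (intro Min_in) auto
    then have m: "item_type P (\<sigma> ! ?m) = item_type P (\<sigma> ! k)" "colour_of P \<sigma> ?m = colour_of P \<sigma> k"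
      using False coloured_bin_same_type[OF cb _ k] by blast+
    have pb: "pure_blue P A \<sigma> b \<longleftrightarrow> colour_of P \<sigma> k = Blue \<and> leaves P (item_type P (\<sigma> ! k)) = 0"
      using k type(2)[OF k] by (auto simp: pure_blue_def Let_def m)
    have unm: "unmixed P A \<sigma> b (item_type P (\<sigma> ! k)) (colour_of P \<sigma> k)" if "\<not> pure_blue P A \<sigma> b"
      unfolding unmixed_def using that type(2)[OF k] k s by blast
    show thesis
      using type[OF k] pb unm pure blue red by (cases "colour_of P \<sigma> k") auto
  qed
qed

text \<open>Union bound behind every count: \<open>p\<close> and \<open>q\<close> select the types
  whose blue and whose red bins suffice to cover all bins outside sand.\<close>

lemma card_used_bins_le:
  assumes "used_bins \<sigma> \<subseteq> sand_bins \<sigma> \<union> (\<Union>i\<in>{i \<in> {1..<ntypes P}. p i}. typed_bins \<sigma> i Blue)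
      \<union> (\<Union>i\<in>{i \<in> {1..<ntypes P}. q i}. typed_bins \<sigma> i Red)"
  shows "real (card (used_bins \<sigma>)) \<le> real (card (sand_bins \<sigma>)) + (\<Sum>i\<in>{1..<ntypes P}.
      of_bool (p i) * real (card (typed_bins \<sigma> i Blue)) + of_bool (q i) * real (card (typed_bins \<sigma> i Red)))"
proof -
  have U: "card (\<Union>i\<in>{i \<in> {1..<ntypes P}. r i}. typed_bins \<sigma> i c)
      \<le> (\<Sum>i\<in>{1..<ntypes P}. of_bool (r i) * card (typed_bins \<sigma> i c))" for r c
  proof -
    have "card (\<Union>i\<in>{i \<in> {1..<ntypes P}. r i}. typed_bins \<sigma> i c)
      \<le> (\<Sum>i\<in>{i \<in> {1..<ntypes P}. r i}. card (typed_bins \<sigma> i c))"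
      by (rule card_UN_le) simp
    also have "\<dots> = (\<Sum>i\<in>{1..<ntypes P}. of_bool (r i) * card (typed_bins \<sigma> i c))"
      by (rule sum.mono_neutral_cong_left) auto
    finally show ?thesis .
  qed
  have "card (used_bins \<sigma>) \<le> card (sand_bins \<sigma> \<union> (\<Union>i\<in>{i \<in> {1..<ntypes P}. p i}. typed_bins \<sigma> i Blue)
      \<union> (\<Union>i\<in>{i \<in> {1..<ntypes P}. q i}. typed_bins \<sigma> i Red))"
    by (rule card_mono) (use assms in auto)
  also have "\<dots> \<le> card (sand_bins \<sigma>) + card (\<Union>i\<in>{i \<in> {1..<ntypes P}. p i}. typed_bins \<sigma> i Blue)
      + card (\<Union>i\<in>{i \<in> {1..<ntypes P}. q i}. typed_bins \<sigma> i Red)"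
    by (intro order_trans[OF card_Un_le] add_right_mono card_Un_le)
  also have "\<dots> \<le> card (sand_bins \<sigma>) + (\<Sum>i\<in>{1..<ntypes P}. of_bool (p i) * card (typed_bins \<sigma> i Blue))
      + (\<Sum>i\<in>{1..<ntypes P}. of_bool (q i) * card (typed_bins \<sigma> i Red))"
    by (intro add_mono U order_refl)
  finally have "real (card (used_bins \<sigma>)) \<le> real (card (sand_bins \<sigma>)
      + (\<Sum>i\<in>{1..<ntypes P}. of_bool (p i) * card (typed_bins \<sigma> i Blue))
      + (\<Sum>i\<in>{1..<ntypes P}. of_bool (q i) * card (typed_bins \<sigma> i Red)))"
    by (simp only: of_nat_le_iff)
  then show ?thesis by (simp add: sum.distrib)
qed

text \<open>
  The fractions of the blue and of the red bins of type \<open>i\<close> that are counted, \<open>lam\<close> being the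
  coefficient of the count that contains all red bins.
\<close>

definition blue_share :: "nat \<Rightarrow> real \<Rightarrow> nat \<Rightarrow> real" where
  "blue_share k lam i = (if k \<le> leaves P i then 1 - lam else 1)"

definition red_share :: "nat \<Rightarrow> real \<Rightarrow> nat \<Rightarrow> real" where
  "red_share k lam i = (if needs P i < k then lam else 1)"

text \<open>\<open>k\<close> depends on the input, whereas \<open>lam\<close> is quantified inside,
  so that a coefficient fixed in advance for each \<open>k\<close> can be inserted.\<close>

lemma bins_by_type:
  assumes "bp_input \<sigma>"
  shows "\<exists>k\<in>{1..Suc (nspaces P)}. \<forall>lam. 0 \<le> lam \<and> lam \<le> 1 \<and> (k = Suc (nspaces P) \<longrightarrow> lam = 0) \<longrightarrow>
    real (card (used_bins \<sigma>)) \<le> real (card (sand_bins \<sigma>)) + (\<Sum>i\<in>{1..<ntypes P}.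
      blue_share k lam i * real (card (typed_bins \<sigma> i Blue)) + red_share k lam i * real (card (typed_bins \<sigma> i Red)))"
proof (cases "\<exists>b j. unmixed P A \<sigma> b j Red")
  case False
  have "used_bins \<sigma> \<subseteq> sand_bins \<sigma> \<union> (\<Union>i\<in>{i \<in> {1..<ntypes P}. True}. typed_bins \<sigma> i Blue)
      \<union> (\<Union>i\<in>{i \<in> {1..<ntypes P}. False}. typed_bins \<sigma> i Red)"
  proof
    fix b assume "b \<in> used_bins \<sigma>"
    show "b \<in> sand_bins \<sigma> \<union> (\<Union>i\<in>{i \<in> {1..<ntypes P}. True}. typed_bins \<sigma> i Blue)
      \<union> (\<Union>i\<in>{i \<in> {1..<ntypes P}. False}. typed_bins \<sigma> i Red)"
    proof (cases "b \<in> sand_bins \<sigma>")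
      case False
      with assms \<open>b \<in> used_bins \<sigma>\<close> show ?thesis
        by (cases rule: used_bin_cases) (use \<open>\<nexists>b j. unmixed P A \<sigma> b j Red\<close> in auto)
    qed simp
  qed
  note bound = card_used_bins_le[OF this]
  show ?thesis
  proof (intro bexI[of _ "Suc (nspaces P)"] allI impI)
    fix lam :: real
    assume lam: "0 \<le> lam \<and> lam \<le> 1 \<and> (Suc (nspaces P) = Suc (nspaces P) \<longrightarrow> lam = 0)"
    \<comment> \<open>No type needs or leaves a space beyond \<open>nspaces P\<close>; with
      \<open>lam\<close> equal to 0 this value of \<open>k\<close> therefore counts all blue bins
      and no red ones.\<close>
    have "blue_share (Suc (nspaces P)) lam i = 1" "red_share (Suc (nspaces P)) lam i = 0"
      if "i \<in> {1..<ntypes P}" for i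
      using that lam red_props(3,4)[of i] by (auto simp: blue_share_def red_share_def)
    with bound show "real (card (used_bins \<sigma>)) \<le> real (card (sand_bins \<sigma>)) + (\<Sum>i\<in>{1..<ntypes P}.
        blue_share (Suc (nspaces P)) lam i * real (card (typed_bins \<sigma> i Blue))
        + red_share (Suc (nspaces P)) lam i * real (card (typed_bins \<sigma> i Red)))"
      by simp
  qed simp
next
  case True
  define R where "R = {j. \<exists>b. unmixed P A \<sigma> b j Red}"
  obtain j0 where j0: "j0 \<in> R" "\<And>j. j \<in> R \<Longrightarrow> needs P j0 \<le> needs P j"
    using True arg_min_natI[of "\<lambda>j. j \<in> R" _ "needs P"] arg_min_nat_le[of "\<lambda>j. j \<in> R" _ "needs P"]
    unfolding R_def by blast
  define k where "k = needs P j0"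
  obtain b0 where b0: "unmixed P A \<sigma> b0 j0 Red" using j0 by (auto simp: R_def)
  obtain l where l: "l \<in> bin_items A \<sigma> b0" "item_type P (\<sigma> ! l) = j0" "colour_of P \<sigma> l = Red"
  proof -
    have "bin_items A \<sigma> b0 \<noteq> {}" "bin_items A \<sigma> b0 = typed_items P A \<sigma> b0 j0 Red"
      using b0 unfolding unmixed_def by blast+
    then show thesis using that unfolding typed_items_def by blast
  qed
  have j0': "1 \<le> j0" "j0 \<le> ntypes P"
    using item_type_props(1,2) bp_input_nth[OF assms bin_items_less[OF l(1)]] l(2) by auto
  \<comment> \<open>A red item forces a positive fraction and thus a nonzero \<open>needs\<close>.
    Since \<open>k\<close> is positive, pure blue bins, whose type has \<open>leaves\<close> 0, are
    among those with \<open>leaves\<close> below \<open>k\<close>.\<close>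
  have k: "1 \<le> k" "k \<le> nspaces P"
    using colour_Red_imp_red_pos[OF l(3)] red_props(1,4,5)[OF j0'] l(2) by (auto simp: k_def)
  have leaves: "leaves P i < k" if "unmixed P A \<sigma> b i Blue" for b i
    using unmixed_incompatible[OF assms that b0] by (simp add: k_def)
  have needs: "k \<le> needs P j" if "unmixed P A \<sigma> b j Red" for b j
    using j0(2)[of j] that by (auto simp: k_def R_def)
  have boundA: "real (card (used_bins \<sigma>)) \<le> real (card (sand_bins \<sigma>)) + (\<Sum>i\<in>{1..<ntypes P}.
      of_bool (leaves P i < k) * real (card (typed_bins \<sigma> i Blue)) + of_bool True * real (card (typed_bins \<sigma> i Red)))"
    (is "?U \<le> ?S + sum ?A _")
  proof (rule card_used_bins_le, rule subsetI)
    fix b assume "b \<in> used_bins \<sigma>"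
    show "b \<in> sand_bins \<sigma> \<union> (\<Union>i\<in>{i \<in> {1..<ntypes P}. leaves P i < k}. typed_bins \<sigma> i Blue)
      \<union> (\<Union>i\<in>{i \<in> {1..<ntypes P}. True}. typed_bins \<sigma> i Red)"
    proof (cases "b \<in> sand_bins \<sigma>")
      case False
      with assms \<open>b \<in> used_bins \<sigma>\<close> show ?thesis
        by (cases rule: used_bin_cases) (use leaves k in auto)
    qed simp
  qed
  have boundB: "real (card (used_bins \<sigma>)) \<le> real (card (sand_bins \<sigma>)) + (\<Sum>i\<in>{1..<ntypes P}.
      of_bool True * real (card (typed_bins \<sigma> i Blue)) + of_bool (k \<le> needs P i) * real (card (typed_bins \<sigma> i Red)))"
    (is "_ \<le> _ + sum ?B _")
  proof (rule card_used_bins_le, rule subsetI)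
    fix b assume "b \<in> used_bins \<sigma>"
    show "b \<in> sand_bins \<sigma> \<union> (\<Union>i\<in>{i \<in> {1..<ntypes P}. True}. typed_bins \<sigma> i Blue)
      \<union> (\<Union>i\<in>{i \<in> {1..<ntypes P}. k \<le> needs P i}. typed_bins \<sigma> i Red)"
    proof (cases "b \<in> sand_bins \<sigma>")
      case False
      with assms \<open>b \<in> used_bins \<sigma>\<close> show ?thesis
        by (cases rule: used_bin_cases) (use needs in auto)
    qed simp
  qed
  show ?thesis
  proof (intro bexI[of _ k] allI impI)
    fix lam :: real
    assume lam: "0 \<le> lam \<and> lam \<le> 1 \<and> (k = Suc (nspaces P) \<longrightarrow> lam = 0)"
    have "?U = lam * ?U + (1 - lam) * ?U" by (simp add: algebra_simps)
    also have "\<dots> \<le> lam * (?S + sum ?A {1..<ntypes P}) + (1 - lam) * (?S + sum ?B {1..<ntypes P})"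
      using lam by (intro add_mono mult_left_mono boundA boundB) auto
    also have "\<dots> = ?S + (\<Sum>i\<in>{1..<ntypes P}. lam * ?A i + (1 - lam) * ?B i)"
      by (simp only: sum.distrib sum_distrib_left[symmetric]) (simp add: algebra_simps)
    also have "(\<Sum>i\<in>{1..<ntypes P}. lam * ?A i + (1 - lam) * ?B i) = (\<Sum>i\<in>{1..<ntypes P}.
        blue_share k lam i * real (card (typed_bins \<sigma> i Blue)) + red_share k lam i * real (card (typed_bins \<sigma> i Red)))"
      by (rule sum.cong) (auto simp: blue_share_def red_share_def algebra_simps)
    finally show "real (card (used_bins \<sigma>)) \<le> real (card (sand_bins \<sigma>)) + (\<Sum>i\<in>{1..<ntypes P}.
        blue_share k lam i * real (card (typed_bins \<sigma> i Blue)) + red_share k lam i * real (card (typed_bins \<sigma> i Red)))" .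
  qed (use k in auto)
qed

text \<open>The long-run numbers of blue and of red bins per item of type \<open>i\<close>, each
  scaled by its counted share. For fraction 0 the red term vanishes whatever \<open>redfit\<close>
  is.\<close>

definition type_weight :: "nat \<Rightarrow> real \<Rightarrow> nat \<Rightarrow> real" where
  "type_weight k lam i = (1 - red P i) / bluefit P i * blue_share k lam i + red P i / redfit P i * red_share k lam i"

definition weight :: "nat \<Rightarrow> real \<Rightarrow> real \<Rightarrow> real" where
  "weight k lam s = (if item_type P s = ntypes P then s / (1 - thr P (ntypes P)) else type_weight k lam (item_type P s))"

lemma sum_weight:
  assumes "bp_input \<sigma>"
  shows "(\<Sum>l<length \<sigma>. weight k lam (\<sigma> ! l)) = (\<Sum>l\<in>sand_items \<sigma>. \<sigma> ! l) / (1 - thr P (ntypes P))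
    + (\<Sum>i\<in>{1..<ntypes P}. type_weight k lam i * n_items P \<sigma> i (length \<sigma>))"
proof -
  let ?G = "\<lambda>i. {l \<in> {..<length \<sigma>}. item_type P (\<sigma> ! l) = i}"
  have "(\<Sum>l<length \<sigma>. weight k lam (\<sigma> ! l)) = (\<Sum>i\<in>{1..ntypes P}. \<Sum>l\<in>?G i. weight k lam (\<sigma> ! l))"
    by (rule sum.group[symmetric]) (use item_type_props(1,2) bp_input_nth[OF assms] in auto)
  also have "{1..ntypes P} = insert (ntypes P) {1..<ntypes P}" using N_ge_1 by auto
  also have "(\<Sum>i\<in>insert (ntypes P) {1..<ntypes P}. \<Sum>l\<in>?G i. weight k lam (\<sigma> ! l)) =
      (\<Sum>l\<in>?G (ntypes P). weight k lam (\<sigma> ! l)) + (\<Sum>i\<in>{1..<ntypes P}. \<Sum>l\<in>?G i. weight k lam (\<sigma> ! l))"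
    by simp
  also have "(\<Sum>l\<in>?G (ntypes P). weight k lam (\<sigma> ! l)) = (\<Sum>l\<in>sand_items \<sigma>. \<sigma> ! l) / (1 - thr P (ntypes P))"
    unfolding sum_divide_distrib by (rule sum.cong) (auto simp: sand_items_def weight_def)
  also have "(\<Sum>i\<in>{1..<ntypes P}. \<Sum>l\<in>?G i. weight k lam (\<sigma> ! l)) =
      (\<Sum>i\<in>{1..<ntypes P}. type_weight k lam i * n_items P \<sigma> i (length \<sigma>))"
  proof (rule sum.cong)
    fix i assume i: "i \<in> {1..<ntypes P}"
    have "(\<Sum>l\<in>?G i. weight k lam (\<sigma> ! l)) = (\<Sum>l\<in>?G i. type_weight k lam i)"
      using i by (intro sum.cong) (auto simp: weight_def)
    then show "(\<Sum>l\<in>?G i. weight k lam (\<sigma> ! l)) = type_weight k lam i * n_items P \<sigma> i (length \<sigma>)"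
      by (simp add: n_items_def)
  qed simp
  finally show ?thesis .
qed

text \<open>Shares are at most 1, so each type costs at most 2 extra blue bins and 1 extra red bin;
  the current sand bin accounts for the remaining 1.\<close>

lemma bins_used_le_weight:
  assumes "bp_input \<sigma>" "thr P (ntypes P) < 1"
  shows "\<exists>k\<in>{1..Suc (nspaces P)}. \<forall>lam. 0 \<le> lam \<and> lam \<le> 1 \<and> (k = Suc (nspaces P) \<longrightarrow> lam = 0) \<longrightarrow>
    real (bins_used A \<sigma>) \<le> (\<Sum>l<length \<sigma>. weight k lam (\<sigma> ! l)) + (1 + 3 * real (ntypes P))"
proof -
  obtain k where k: "k \<in> {1..Suc (nspaces P)}" and bound:
    "\<And>lam. 0 \<le> lam \<and> lam \<le> 1 \<and> (k = Suc (nspaces P) \<longrightarrow> lam = 0) \<Longrightarrow>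
    real (card (used_bins \<sigma>)) \<le> real (card (sand_bins \<sigma>)) + (\<Sum>i\<in>{1..<ntypes P}.
      blue_share k lam i * real (card (typed_bins \<sigma> i Blue)) + red_share k lam i * real (card (typed_bins \<sigma> i Red)))"
    using bins_by_type[OF assms(1)] by blast
  have "real (bins_used A \<sigma>) \<le> (\<Sum>l<length \<sigma>. weight k lam (\<sigma> ! l)) + (1 + 3 * real (ntypes P))"
    if lam: "0 \<le> lam \<and> lam \<le> 1 \<and> (k = Suc (nspaces P) \<longrightarrow> lam = 0)" for lam
  proof -
    have "(\<Sum>i\<in>{1..<ntypes P}. blue_share k lam i * real (card (typed_bins \<sigma> i Blue))
        + red_share k lam i * real (card (typed_bins \<sigma> i Red)))
      \<le> (\<Sum>i\<in>{1..<ntypes P}. type_weight k lam i * n_items P \<sigma> i (length \<sigma>) + 3)"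
    proof (rule sum_mono)
      fix i assume i: "i \<in> {1..<ntypes P}"
      let ?n = "real (n_items P \<sigma> i (length \<sigma>))"
      have sh: "0 \<le> blue_share k lam i" "blue_share k lam i \<le> 1" "0 \<le> red_share k lam i" "red_share k lam i \<le> 1"
        using lam by (auto simp: blue_share_def red_share_def)
      have "blue_share k lam i * real (card (typed_bins \<sigma> i Blue)) \<le> blue_share k lam i * ((1 - red P i) / bluefit P i * ?n + 2)"
        using i by (intro mult_left_mono card_blue_bins_le assms sh) auto
      moreover have "red_share k lam i * real (card (typed_bins \<sigma> i Red)) \<le> red_share k lam i * (red P i / redfit P i * ?n + 1)"
        using i by (intro mult_left_mono card_red_bins_le assms sh) auto
      ultimately show "blue_share k lam i * real (card (typed_bins \<sigma> i Blue)) + red_share k lam i * real (card (typed_bins \<sigma> i Red))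
          \<le> type_weight k lam i * ?n + 3"
        using sh unfolding type_weight_def ring_distribs by (simp add: mult_ac)
    qed
    also have "\<dots> \<le> (\<Sum>i\<in>{1..<ntypes P}. type_weight k lam i * n_items P \<sigma> i (length \<sigma>)) + 3 * real (ntypes P)"
      by (simp add: sum.distrib)
    finally show ?thesis
      using bound[OF lam] card_sand_bins_le[OF assms] sum_weight[OF assms(1), of k lam]
      by (simp add: bins_used_def used_bins_def)
  qed
  with k show ?thesis by blast
qed

lemma asymptotic_ratio_le:
  assumes thr: "thr P (ntypes P) < 1"
    and lam: "\<And>k. k \<in> {1..Suc (nspaces P)} \<Longrightarrow> 0 \<le> lam k \<and> lam k \<le> 1" "lam (Suc (nspaces P)) = 0"
    and pattern: "\<And>k B x. k \<in> {1..Suc (nspaces P)} \<Longrightarrow> finite (B :: nat set) \<Longrightarrow>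
      (\<And>l. l \<in> B \<Longrightarrow> 0 < x l \<and> x l \<le> 1) \<Longrightarrow> (\<Sum>l\<in>B. x l) \<le> 1 \<Longrightarrow>
      (\<Sum>l\<in>B. weight k (lam k) (x l)) \<le> c"
    and "c < c'"
  shows "asymptotic_ratio A \<le> ereal c'"
proof -
  define C where "C = 1 + 3 * real (ntypes P)"
  have bound: "real (bins_used A \<sigma>) \<le> c * real (opt \<sigma>) + C" if inp: "bp_input \<sigma>" for \<sigma>
  proof -
    obtain k where k: "k \<in> {1..Suc (nspaces P)}"
      and used: "real (bins_used A \<sigma>) \<le> (\<Sum>l<length \<sigma>. weight k (lam k) (\<sigma> ! l)) + C"
      using bins_used_le_weight[OF inp thr] lam unfolding C_def by blast
    obtain f where f: "\<And>k. k < length \<sigma> \<Longrightarrow> f k < opt \<sigma>"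
      "\<And>b. b < opt \<sigma> \<Longrightarrow> (\<Sum>k | k < length \<sigma> \<and> f k = b. \<sigma> ! k) \<le> 1"
      using opt_packing[OF inp] by blast
    \<comment> \<open>The weight is additive over items, so it can be regrouped along the bins of an
      optimal packing, each of which is a pattern of total size at most 1.\<close>
    have "(\<Sum>l<length \<sigma>. weight k (lam k) (\<sigma> ! l)) =
        (\<Sum>b<opt \<sigma>. \<Sum>l\<in>{l \<in> {..<length \<sigma>}. f l = b}. weight k (lam k) (\<sigma> ! l))"
      by (rule sum.group[symmetric]) (use f(1) in auto)
    also have "\<dots> \<le> (\<Sum>b<opt \<sigma>. c)"
    proof (rule sum_mono, rule pattern[OF k])
      fix b assume "b \<in> {..<opt \<sigma>}"
      then show "(\<Sum>l\<in>{l \<in> {..<length \<sigma>}. f l = b}. \<sigma> ! l) \<le> 1" using f(2) by simp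
    qed (use bp_input_nth[OF inp] in auto)
    finally show ?thesis using used by (simp add: mult.commute)
  qed
  \<comment> \<open>From \<open>n0\<close> on, the constant \<open>C\<close> is at most
    \<open>c' - c\<close> times the optimum; the added 1 keeps the optimum positive as a
    divisor.\<close>
  define n0 where "n0 = nat \<lceil>C / (c' - c)\<rceil> + 1"
  have "ereal (real (bins_used A \<sigma>) / real (opt \<sigma>)) \<le> ereal c'"
    if "n0 \<le> opt \<sigma>" "bp_input \<sigma>" for \<sigma>
  proof -
    have "C / (c' - c) \<le> real (opt \<sigma>)" "0 < real (opt \<sigma>)"
      using that(1) unfolding n0_def by linarith+
    then have "C \<le> (c' - c) * real (opt \<sigma>)" using \<open>c < c'\<close> by (simp add: field_simps)
    then have "real (bins_used A \<sigma>) \<le> c' * real (opt \<sigma>)"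
      using bound[OF that(2)] by (simp add: algebra_simps)
    then show ?thesis using \<open>0 < real (opt \<sigma>)\<close> by (simp add: field_simps)
  qed
  then show ?thesis
    unfolding asymptotic_ratio_def
    by (intro Limsup_bounded eventually_sequentiallyI[of n0] SUP_least) auto
qed

text \<open>Every item is charged the density of sand times its size, which costs a bin at most
  \<open>1 / (1 - thr P (ntypes P))\<close> and covers sand exactly. What remains is the gain of the
  other types over sand, bounded by its value at the lower end of each type, so that sand and exact
  sizes disappear from the problem.\<close>

lemma weight_sum_le:
  fixes B :: "nat set"
  assumes "finite B" "\<And>l. l \<in> B \<Longrightarrow> 0 < x l \<and> x l \<le> 1" "(\<Sum>l\<in>B. x l) \<le> 1"
    and "thr P (ntypes P) < 1"
    and gain: "\<And>(C :: nat set) t. finite C \<Longrightarrow> t ` C \<subseteq> {1..<ntypes P} \<Longrightarrow>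
      (\<Sum>l\<in>C. thr P (Suc (t l))) < 1 \<Longrightarrow>
      (\<Sum>l\<in>C. type_weight k lam (t l) - thr P (Suc (t l)) / (1 - thr P (ntypes P)))
        \<le> c - 1 / (1 - thr P (ntypes P))"
  shows "(\<Sum>l\<in>B. weight k lam (x l)) \<le> c"
proof -
  let ?d = "1 / (1 - thr P (ntypes P))" and ?t = "\<lambda>l. item_type P (x l)"
  let ?C = "{l \<in> B. ?t l \<noteq> ntypes P}"
  have d: "0 < ?d" using assms(4) by simp
  have t: "1 \<le> ?t l" "?t l \<le> ntypes P" "?t l \<noteq> ntypes P \<Longrightarrow> thr P (Suc (?t l)) < x l" if "l \<in> B" for l
    using item_type_props(1,2,4)[of "x l"] assms(2)[OF that] by auto
  \<comment> \<open>Types are intervals open on the left, so the lower ends sum to strictly less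
    than 1. This excludes, for instance, two items of a type with lower end 1/2.\<close>
  have "(\<Sum>l\<in>?C. thr P (Suc (?t l))) < 1"
  proof (cases "?C = {}")
    case True
    then show ?thesis by (simp only: sum.empty)
  next
    case False
    have "(\<Sum>l\<in>?C. thr P (Suc (?t l))) < (\<Sum>l\<in>?C. x l)"
      by (rule sum_strict_mono) (use assms(1) False t in auto)
    also have "\<dots> \<le> (\<Sum>l\<in>B. x l)"
      by (rule sum_mono2) (use assms(1,2) in \<open>auto intro: less_imp_le\<close>)
    finally show ?thesis using assms(3) by simp
  qed
  moreover have "?t ` ?C \<subseteq> {1..<ntypes P}"
  proof (rule image_subsetI)
    fix l assume "l \<in> ?C"
    then show "?t l \<in> {1..<ntypes P}" using t(1,2)[of l] by simp
  qed
  ultimately have "(\<Sum>l\<in>?C. type_weight k lam (?t l) - thr P (Suc (?t l)) / (1 - thr P (ntypes P))) \<le> c - ?d"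
    using assms(1) by (intro gain[where C = ?C and t = ?t]) simp_all
  moreover have "(\<Sum>l\<in>B. weight k lam (x l)) \<le> (\<Sum>l\<in>B. ?d * x l +
      (if ?t l \<noteq> ntypes P then type_weight k lam (?t l) - thr P (Suc (?t l)) / (1 - thr P (ntypes P)) else 0))"
  proof (rule sum_mono)
    fix l assume l: "l \<in> B"
    show "weight k lam (x l) \<le> ?d * x l +
      (if ?t l \<noteq> ntypes P then type_weight k lam (?t l) - thr P (Suc (?t l)) / (1 - thr P (ntypes P)) else 0)"
    proof (cases "?t l = ntypes P")
      case True
      then show ?thesis by (simp add: weight_def)
    next
      case False
      have "?d * thr P (Suc (?t l)) \<le> ?d * x l"
        using t(3)[OF l False] d by (intro mult_left_mono) auto
      then show ?thesis using False by (simp add: weight_def)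
    qed
  qed
  moreover have "\<dots> = ?d * (\<Sum>l\<in>B. x l) +
      (\<Sum>l\<in>?C. type_weight k lam (?t l) - thr P (Suc (?t l)) / (1 - thr P (ntypes P)))"
    using assms(1) by (simp add: sum.distrib sum_distrib_left sum.inter_filter)
  moreover have "?d * (\<Sum>l\<in>B. x l) \<le> ?d * 1"
    using assms(3) d by (intro mult_left_mono) auto
  ultimately show ?thesis by simp
qed

end

section \<open>Branch and bound for the knapsack problem\<close>

text \<open>
  The items are pairs of a size and a gain, of which any number of copies may be used. A branch is
  cut off if no remaining item has a gain per size above \<open>bound / room\<close>. The nested conditionals make
  the simplifier evaluate lazily.
\<close>

function gain_check :: "(int \<times> int) list \<Rightarrow> int \<Rightarrow> int \<Rightarrow> bool" where
  "gain_check [] room bound = (0 \<le> bound)"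
| "gain_check ((s, g) # xs) room bound =
     (if 0 \<le> bound \<and> list_all (\<lambda>(s, g). g * room \<le> bound * s) ((s, g) # xs) then True
      else if 0 < s then
        (if s < room
         then (if gain_check ((s, g) # xs) (room - s) (bound - g) then gain_check xs room bound else False)
         else gain_check xs room bound)
      else False)"
  by pat_completeness auto
termination
  by (relation "measures [\<lambda>(xs, _, _). length xs, \<lambda>(_, room, _). nat room]") auto

declare gain_check.simps [simp del]

lemma gain_check_sound:
  assumes "gain_check xs room bound" "\<forall>(s, g)\<in>set xs. 0 < s"
    and "finite B" "f ` B \<subseteq> set xs" "(\<Sum>b\<in>B. fst (f b)) < room"
  shows "(\<Sum>b\<in>B. snd (f b)) \<le> bound"
  using assms
proof (induction xs room bound arbitrary: B rule: gain_check.induct)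
  case (1 room bound)
  then show ?case by (simp add: gain_check.simps)
next
  case (2 s g xs room bound)
  have pos: "0 < fst (f b)" if "b \<in> B" for b
    using "2.prems"(2,4) that by fastforce
  have total_nonneg: "0 \<le> (\<Sum>b\<in>B. fst (f b))"
    using pos by (intro sum_nonneg) (auto intro: less_imp_le)
  let ?prune = "0 \<le> bound \<and> list_all (\<lambda>(s, g). g * room \<le> bound * s) ((s, g) # xs)"
  show ?case
  proof (cases ?prune)
    case True
    have "snd (f b) * room \<le> bound * fst (f b)" if "b \<in> B" for b
    proof -
      have "f b \<in> set ((s, g) # xs)" using "2.prems"(4) that by blast
      moreover have "\<forall>y\<in>set ((s, g) # xs). case y of (s, g) \<Rightarrow> g * room \<le> bound * s"
        using True unfolding list_all_iff by blast
      ultimately have "case f b of (s, g) \<Rightarrow> g * room \<le> bound * s" by (rule bspec[rotated])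
      then show ?thesis by (simp add: case_prod_beta)
    qed
    then have "(\<Sum>b\<in>B. snd (f b)) * room \<le> bound * (\<Sum>b\<in>B. fst (f b))"
      by (simp add: sum_distrib_left sum_distrib_right sum_mono)
    \<comment> \<open>This uses that \<open>bound\<close> is nonnegative. The factor
      \<open>room\<close> cancels afterwards, being larger than the nonnegative total size.\<close>
    also have "\<dots> \<le> bound * room"
      using True "2.prems"(5) by (intro mult_left_mono) auto
    finally show ?thesis using "2.prems"(5) total_nonneg by simp
  next
    case False
    then have rest: "gain_check xs room bound"
      and sub: "s < room \<Longrightarrow> gain_check ((s, g) # xs) (room - s) (bound - g)"
      and s: "0 < s"
      using "2.prems"(1) unfolding gain_check.simps(2)[of s g xs room bound] if_not_P[OF False]
      by (auto split: if_splits)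
    show ?thesis
    proof (cases "\<exists>b\<in>B. f b = (s, g)")
      case True
      then obtain b where b: "b \<in> B" "f b = (s, g)" by blast
      have fst: "(\<Sum>b\<in>B. fst (f b)) = s + (\<Sum>b\<in>B - {b}. fst (f b))"
        using sum.remove[OF "2.prems"(3) b(1), of "\<lambda>b. fst (f b)"] b(2) by simp
      have "0 \<le> (\<Sum>b\<in>B - {b}. fst (f b))"
        using pos by (intro sum_nonneg) (auto intro: less_imp_le)
      then have "s < room" using fst "2.prems"(5) by simp
      have "(\<Sum>b\<in>B - {b}. snd (f b)) \<le> bound - g"
        using "2.prems"(2-5) fst
        by (intro "2.IH"(1)[OF False s \<open>s < room\<close> sub[OF \<open>s < room\<close>]]) auto
      then show ?thesis
        using sum.remove[OF "2.prems"(3) b(1), of "\<lambda>b. snd (f b)"] b(2) by simp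
    next
      case no: False
      have sub': "f ` B \<subseteq> set xs" using no "2.prems"(4) by force
      show ?thesis
      proof (cases "s < room")
        case True
        show ?thesis
          by (rule "2.IH"(2)[OF False s True sub[OF True] rest]) (use "2.prems" sub' in auto)
      next
        case ge: False
        show ?thesis
          by (rule "2.IH"(3)[OF False s ge rest]) (use "2.prems" sub' in auto)
      qed
    qed
  qed
qed

section \<open>The parameters\<close>

text \<open>
  Entry \<open>i\<close> of each table belongs to type \<open>Suc i\<close> (to space \<open>Suc i\<close> in the case of \<open>space_tab\<close>).
  Thresholds are fractions; spaces are in units of \<open>1/1000\<close>, red fractions of \<open>1/10000\<close>, and the
  coefficients \<open>lam_tab\<close> of \<open>1/100\<close>. Entry 10 of \<open>lam_tab\<close> covers the case without unmixed red bins.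
\<close>

definition thr_tab :: "(int \<times> int) list" where
  "thr_tab = [(1, 1), (665, 1000), (662, 1000), (656, 1000), (644, 1000), (624, 1000), (584, 1000),
     (1, 2), (416, 1000), (376, 1000), (356, 1000), (344, 1000), (338, 1000), (335, 1000), (1, 3),
     (288, 1000), (1, 4), (1, 5), (1, 6), (147, 1000), (1, 7), (1, 8), (1, 9), (1, 10), (1, 11),
     (1, 12), (1, 14), (1, 16), (1, 18), (1, 19), (1, 22), (1, 23)]"

definition space_tab :: "int list" where
  "space_tab = [147, 282, 288, 308, 335, 338, 344, 356, 376, 416]"

definition red_tab :: "int list" where
  "red_tab = [0, 0, 0, 0, 0, 0, 0, 0, 832, 1252, 1502, 1628, 1690, 1726, 0, 973, 608, 0,
     778, 1036, 851, 704, 595, 500, 419, 1036, 858, 704, 100, 975, 0, 0]"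

definition leaves_tab :: "nat list" where
  "leaves_tab = [0, 5, 6, 7, 8, 9, 10, 0, 1, 1, 3, 4, 4, 4, 0, 0, 0, 0, 0, 0, 0, 0, 0, 0, 0, 0, 0,
     0, 0, 0, 0, 0]"

definition needs_tab :: "nat list" where
  "needs_tab = [0, 0, 0, 0, 0, 0, 0, 0, 10, 9, 8, 7, 6, 5, 0, 3, 3, 0, 2, 4, 4, 4, 4, 2, 1, 2, 2,
     3, 1, 2, 0, 0]"

definition lam_tab :: "int list" where
  "lam_tab = [21, 21, 21, 21, 19, 19, 18, 17, 14, 10, 0]"

definition num :: "nat \<Rightarrow> int" where "num i = fst (thr_tab ! i)"

definition den :: "nat \<Rightarrow> int" where "den i = snd (thr_tab ! i)"

definition params :: sh_params where
  "params = \<lparr>ntypes = 32, thr = \<lambda>j. num (j - 1) / den (j - 1),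
     nspaces = 10, redspace = \<lambda>k. space_tab ! (k - 1) / 1000,
     red = \<lambda>j. red_tab ! (j - 1) / 10000,
     leaves = \<lambda>j. leaves_tab ! (j - 1), needs = \<lambda>j. needs_tab ! (j - 1)\<rparr>"

lemma params_simps:
  "ntypes params = 32" "nspaces params = 10"
  "thr params (Suc i) = num i / den i"
  "red params (Suc i) = red_tab ! i / 10000"
  "leaves params (Suc i) = leaves_tab ! i" "needs params (Suc i) = needs_tab ! i"
  by (simp_all add: params_def)

definition lam :: "nat \<Rightarrow> real" where "lam k = lam_tab ! (k - 1) / 100"

definition bfit :: "nat \<Rightarrow> int" where "bfit i = den i div num i"

definition rfit :: "nat \<Rightarrow> int" where
  "rfit i = (space_tab ! (needs_tab ! i - 1) * den i) div (1000 * num i)"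

text \<open>The thresholds have the common denominator \<open>2000 * 9 * 7 * 11 * 19 * 23\<close>.\<close>

definition grid :: int where "grid = 605682000"

text \<open>The lower end of type \<open>Suc i\<close> in grid units is the threshold of the next
  type, hence the shift of the index.\<close>

definition low :: "nat \<Rightarrow> int" where "low i = grid * num (Suc i) div den (Suc i)"

text \<open>The weight of type \<open>Suc i\<close> in units of \<open>1/660000000\<close>.\<close>

definition int_weight :: "nat \<Rightarrow> nat \<Rightarrow> int" where
  "int_weight k i =
     (10000 - red_tab ! i) * 660 div bfit i * (if k \<le> leaves_tab ! i then 100 - lam_tab ! (k - 1) else 100) +
     (if needs_tab ! i = 0 then 0
      else red_tab ! i * 660 div rfit i * (if needs_tab ! i < k then lam_tab ! (k - 1) else 100))"

text \<open>Sand has density \<open>23/22\<close>. Gains are in units of \<open>1/(660000000 * grid)\<close>.\<close>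

definition gains :: "nat \<Rightarrow> (int \<times> int) list" where
  "gains k = map (\<lambda>i. (low i, grid * int_weight k i - 690000000 * low i)) [0..<31]"

text \<open>The bound 1.5882 minus the sand density 23/22 in the units of the gains: 15882 * 66000
  is 1.5882 * 660000000, and 690000000 is 23/22 * 660000000.\<close>

definition max_gain :: int where "max_gain = (15882 * 66000 - 690000000) * grid"

lemma gain_checks_1: "list_all (\<lambda>k. gain_check (gains k) grid max_gain) [1..<6]"
  by code_simp

lemma gain_checks_2: "list_all (\<lambda>k. gain_check (gains k) grid max_gain) [6..<12]"
  by code_simp

lemma gain_check_gains:
  assumes "k \<in> {1..11}"
  shows "gain_check (gains k) grid max_gain"
proof -
  have "k \<in> set ([1..<6] @ [6..<12])" using assms by auto
  then show ?thesis using gain_checks_1 gain_checks_2 by (auto simp only: list_all_iff set_append)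
qed

section \<open>Checks of the tables\<close>

definition row_ok :: "nat \<Rightarrow> bool" where
  "row_ok i \<longleftrightarrow> 0 < num i \<and> 0 < den i \<and> 0 < bfit i \<and> 0 \<le> red_tab ! i \<and> red_tab ! i \<le> 10000 \<and>
     leaves_tab ! i \<le> 10 \<and> needs_tab ! i \<le> 10 \<and> (needs_tab ! i = 0 \<longleftrightarrow> red_tab ! i = 0) \<and>
     (needs_tab ! i = 0 \<or> 1 \<le> rfit i \<and> rfit i dvd red_tab ! i * 660) \<and>
     (leaves_tab ! i = 0 \<or>
      space_tab ! (leaves_tab ! i - 1) * den i \<le> 1000 * (den i - bfit i * num i))"

text \<open>The divisibility conditions make the integer divisions in \<open>low\<close> and in the
  blue part of \<open>int_weight\<close> exact. The values 7, 8, 9, 14, 16, 18 and 19 of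
  \<open>bfit\<close> do not divide 660; there the red fraction is chosen so that
  \<open>10000 - red_tab ! i\<close> supplies the missing factor.\<close>

definition next_ok :: "nat \<Rightarrow> bool" where
  "next_ok i \<longleftrightarrow> num (Suc i) * den i \<le> num i * den (Suc i) \<and> den (Suc i) dvd grid * num (Suc i) \<and> 0 < low i \<and>
     bfit i dvd (10000 - red_tab ! i) * 660"

lemma tables_ok:
  "list_all row_ok [0..<32]" "list_all next_ok [0..<31]"
  "list_all (\<lambda>s. 0 < s \<and> s < 1000) space_tab"
  "list_all (\<lambda>k. space_tab ! k \<le> space_tab ! Suc k) [0..<9]"
  "list_all (\<lambda>l. 0 \<le> l \<and> l \<le> 100) lam_tab"
  by code_simp+

lemma row_okD:
  assumes "i < 32"
  shows "0 < num i" "0 < den i" "0 < bfit i" "0 \<le> red_tab ! i" "red_tab ! i \<le> 10000"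
    "leaves_tab ! i \<le> 10" "needs_tab ! i \<le> 10" "needs_tab ! i = 0 \<longleftrightarrow> red_tab ! i = 0"
    "needs_tab ! i \<noteq> 0 \<Longrightarrow> 1 \<le> rfit i" "needs_tab ! i \<noteq> 0 \<Longrightarrow> rfit i dvd red_tab ! i * 660"
    "leaves_tab ! i \<noteq> 0 \<Longrightarrow>
       space_tab ! (leaves_tab ! i - 1) * den i \<le> 1000 * (den i - bfit i * num i)"
proof -
  have "row_ok i" using tables_ok(1) assms by (simp add: list_all_iff)
  then show "0 < num i" "0 < den i" "0 < bfit i" "0 \<le> red_tab ! i" "red_tab ! i \<le> 10000"
    "leaves_tab ! i \<le> 10" "needs_tab ! i \<le> 10" "needs_tab ! i = 0 \<longleftrightarrow> red_tab ! i = 0"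
    "needs_tab ! i \<noteq> 0 \<Longrightarrow> 1 \<le> rfit i" "needs_tab ! i \<noteq> 0 \<Longrightarrow> rfit i dvd red_tab ! i * 660"
    "leaves_tab ! i \<noteq> 0 \<Longrightarrow>
       space_tab ! (leaves_tab ! i - 1) * den i \<le> 1000 * (den i - bfit i * num i)"
    by (simp_all add: row_ok_def)
qed

lemma next_okD:
  assumes "i < 31"
  shows "num (Suc i) * den i \<le> num i * den (Suc i)" "den (Suc i) dvd grid * num (Suc i)" "0 < low i"
    "bfit i dvd (10000 - red_tab ! i) * 660"
proof -
  have "next_ok i" using tables_ok(2) assms by (simp add: list_all_iff)
  then show "num (Suc i) * den i \<le> num i * den (Suc i)" "den (Suc i) dvd grid * num (Suc i)" "0 < low i"
    "bfit i dvd (10000 - red_tab ! i) * 660"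
    unfolding next_ok_def by blast+
qed

lemma space_bounds: "k < 10 \<Longrightarrow> 0 < space_tab ! k \<and> space_tab ! k < 1000"
  using tables_ok(3) by (simp add: list_all_length space_tab_def)

lemma lam_bounds: "k < 11 \<Longrightarrow> 0 \<le> lam_tab ! k \<and> lam_tab ! k \<le> 100"
  using tables_ok(5) by (simp add: list_all_length lam_tab_def)

section \<open>From the tables to the parameters\<close>

lemma bluefit_params: "i < 32 \<Longrightarrow> int (bluefit params (Suc i)) = bfit i"
proof -
  assume i: "i < 32"
  have "\<lfloor>1 / thr params (Suc i)\<rfloor> = bfit i"
    by (simp add: params_def bfit_def floor_divide_of_int_eq)
  then show ?thesis using row_okD(3)[OF i] by (simp add: bluefit_def)
qed

lemma redfit_params:
  assumes "i < 32" "needs_tab ! i \<noteq> 0"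
  shows "int (redfit params (Suc i)) = rfit i"
proof -
  have "redspace params (needs params (Suc i)) / thr params (Suc i) =
      real_of_int (space_tab ! (needs_tab ! i - 1) * den i) / real_of_int (1000 * num i)"
    by (simp add: params_def)
  then have "\<lfloor>redspace params (needs params (Suc i)) / thr params (Suc i)\<rfloor> = rfit i"
    by (simp only: floor_divide_of_int_eq rfit_def)
  then show ?thesis using row_okD(9)[OF assms] by (simp add: redfit_def)
qed

lemma sh_params_ok_params: "sh_params_ok params"
  unfolding sh_params_ok_def
proof (intro conjI allI impI)
  fix j assume j: "1 \<le> j \<and> j < ntypes params"
  then obtain i where i: "j = Suc i" "i < 31" by (cases j) (auto simp: params_def)
  have "real_of_int (num (Suc i) * den i) \<le> real_of_int (num i * den (Suc i))"
    using next_okD(1)[OF i(2)] by (simp only: of_int_le_iff)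
  then show "thr params (Suc j) \<le> thr params j"
    using row_okD(2)[of i] row_okD(2)[of "Suc i"] i by (simp add: params_def divide_simps mult.commute)
next
  fix k assume k: "1 \<le> k \<and> k \<le> nspaces params"
  then have "k - 1 < 10" by (auto simp: params_def)
  from space_bounds[OF this] show "0 < redspace params k" "redspace params k < 1"
    by (auto simp: params_def)
next
  fix k assume k: "1 \<le> k \<and> k < nspaces params"
  then obtain l where l: "k = Suc l" "l < 9" by (cases k) (auto simp: params_def)
  then have "space_tab ! l \<le> space_tab ! Suc l" using tables_ok(4) by (auto simp: list_all_iff)
  then show "redspace params k \<le> redspace params (Suc k)" using l by (simp add: params_def)
next
  fix j assume j: "1 \<le> j \<and> j \<le> ntypes params"
  then obtain i where i: "j = Suc i" "i < 32" by (cases j) (auto simp: params_def)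
  note row = row_okD[OF i(2)]
  show "0 \<le> red params j" "red params j \<le> 1" "leaves params j \<le> nspaces params"
    "needs params j \<le> nspaces params" "(needs params j = 0) = (red params j = 0)"
    using row(4-8) i by (auto simp: params_def)
  show "1 \<le> redfit params j" if "0 < red params j"
  proof -
    have "needs_tab ! i \<noteq> 0" using that row(8) i by (auto simp: params_def)
    then show ?thesis using redfit_params[OF i(2)] row(9) i by simp
  qed
  show "redspace params (leaves params j) \<le> 1 - real (bluefit params j) * thr params j"
    if "0 < leaves params j"
  proof -
    have "leaves_tab ! i \<noteq> 0" using that i by (simp add: params_def)
    then have "real_of_int (space_tab ! (leaves_tab ! i - 1) * den i)
        \<le> real_of_int (1000 * (den i - bfit i * num i))"
      using row(11) by (metis of_int_le_iff)
    moreover have "real (bluefit params j) = real_of_int (bfit i)"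
      using bluefit_params[OF i(2)] i by (metis of_int_of_nat_eq)
    ultimately show ?thesis
      using row(2) i by (simp add: params_def field_simps)
  qed
next
  show "1 \<le> ntypes params" "thr params 1 = 1" "0 < thr params (ntypes params)"
    by (simp_all add: params_def num_def den_def thr_tab_def)
qed

interpretation params_run: super_harmonic_run params "sh_alg params"
  by unfold_locales (rule sh_params_ok_params super_harmonic_sh_alg)+

section \<open>Integer gains and real weights\<close>

lemma thr_sand: "thr params (ntypes params) = 1 / 23"
  by (simp add: params_def num_def den_def thr_tab_def)

lemma low_eq: "i < 31 \<Longrightarrow> real_of_int (low i) = grid * thr params (Suc (Suc i))"
  using next_okD(2)[of i] by (simp add: low_def params_def real_of_int_div)

text \<open>Nothing is lost by rounding, since the table checks guarantee exact divisions. The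
  factor 660000000 is 10000 * 100 * 660: the units of the red fractions and of \<open>lam\<close>,
  and a common multiple for the numbers of items per bin.\<close>

lemma int_weight_eq:
  assumes i: "i < 31"
  shows "real_of_int (int_weight k i) = 660000000 * params_run.type_weight k (lam k) (Suc i)"
proof -
  have i': "i < 32" using i by simp
  have B: "real (bluefit params (Suc i)) = real_of_int (bfit i)"
    using bluefit_params[OF i'] by (metis of_int_of_nat_eq)
  have "660000000 * ((1 - red params (Suc i)) / bluefit params (Suc i) * params_run.blue_share k (lam k) (Suc i))
      = real_of_int ((10000 - red_tab ! i) * 660 div bfit i *
          (if k \<le> leaves_tab ! i then 100 - lam_tab ! (k - 1) else 100))"
    unfolding B using row_okD(3)[OF i'] next_okD(4)[OF i]
    by (simp add: params_run.blue_share_def params_simps lam_def real_of_int_div field_simps)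
  moreover have "660000000 * (red params (Suc i) / redfit params (Suc i) * params_run.red_share k (lam k) (Suc i))
      = real_of_int (if needs_tab ! i = 0 then 0
          else red_tab ! i * 660 div rfit i * (if needs_tab ! i < k then lam_tab ! (k - 1) else 100))"
  proof (cases "needs_tab ! i = 0")
    case True
    then have "red params (Suc i) = 0" using row_okD(8)[OF i'] by (simp add: params_def)
    then show ?thesis using True by simp
  next
    case False
    have R: "real (redfit params (Suc i)) = real_of_int (rfit i)"
      using redfit_params[OF i' False] by (metis of_int_of_nat_eq)
    show ?thesis
      unfolding R using False row_okD(9,10)[OF i' False]
      by (simp add: params_run.red_share_def params_simps lam_def real_of_int_div field_simps)
  qed
  ultimately show ?thesis
    unfolding params_run.type_weight_def int_weight_def of_int_add ring_distribs by simp
qed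

lemma pattern_weight_le:
  fixes B :: "nat set"
  assumes k: "k \<in> {1..Suc (nspaces params)}"
    and B: "finite B" "\<And>l. l \<in> B \<Longrightarrow> 0 < x l \<and> x l \<le> 1" "(\<Sum>l\<in>B. x l) \<le> 1"
  shows "(\<Sum>l\<in>B. params_run.weight k (lam k) (x l)) \<le> 15882 / 10000"
proof (rule params_run.weight_sum_le[OF B])
  show "thr params (ntypes params) < 1" by (simp add: thr_sand)
next
  fix C :: "nat set" and t
  assume C: "finite C" "t ` C \<subseteq> {1..<ntypes params}" "(\<Sum>l\<in>C. thr params (Suc (t l))) < 1"
  have t: "t l = Suc (t l - 1)" "t l - 1 < 31" if "l \<in> C" for l
  proof -
    have "t l \<in> {1..<32}" using C(2) that by (auto simp: params_def)
    then show "t l = Suc (t l - 1)" "t l - 1 < 31" by auto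
  qed
  \<comment> \<open>This picks the entry of the gain list for item \<open>l\<close>; types start at
    1, list positions at 0.\<close>
  let ?f = "\<lambda>l. (low (t l - 1), grid * int_weight k (t l - 1) - 690000000 * low (t l - 1))"
  have grid: "0 < grid" by (simp add: grid_def)
  have low: "real_of_int (low (t l - 1)) = grid * thr params (Suc (t l))" if "l \<in> C" for l
    using low_eq[OF t(2)[OF that]] t(1)[OF that] by simp
  have wt: "real_of_int (int_weight k (t l - 1)) = 660000000 * params_run.type_weight k (lam k) (t l)"
    if "l \<in> C" for l
    using int_weight_eq[OF t(2)[OF that], of k] t(1)[OF that] by simp
  have "(\<Sum>l\<in>C. snd (?f l)) \<le> max_gain"
  proof (rule gain_check_sound)
    show "gain_check (gains k) grid max_gain"
      using k by (intro gain_check_gains) (simp add: params_def)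
    show "\<forall>(s, g)\<in>set (gains k). 0 < s" using next_okD(3) by (auto simp: gains_def)
    show "?f ` C \<subseteq> set (gains k)"
    proof (rule image_subsetI)
      fix l assume "l \<in> C"
      then show "?f l \<in> set (gains k)" unfolding gains_def set_map
        using t(2) by (intro imageI) simp
    qed
    have "real_of_int (\<Sum>l\<in>C. fst (?f l)) = grid * (\<Sum>l\<in>C. thr params (Suc (t l)))"
      using low by (simp add: sum_distrib_left)
    also have "\<dots> < real_of_int grid * 1"
      using C(3) grid by (intro mult_strict_left_mono) auto
    finally show "(\<Sum>l\<in>C. fst (?f l)) < grid"
      by (simp only: mult_1_right of_int_less_iff)
  qed (rule C(1))
  then have "real_of_int (\<Sum>l\<in>C. snd (?f l)) \<le> real_of_int max_gain"
    by (simp only: of_int_le_iff)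
  \<comment> \<open>The scale \<open>660000000 * grid\<close> clears the denominators of weights and
    thresholds at once.\<close>
  moreover have "real_of_int (\<Sum>l\<in>C. snd (?f l)) = 660000000 * real_of_int grid *
      (\<Sum>l\<in>C. params_run.type_weight k (lam k) (t l) - thr params (Suc (t l)) / (1 - thr params (ntypes params)))"
    unfolding of_int_sum sum_distrib_left
  proof (rule sum.cong)
    fix l assume l: "l \<in> C"
    show "real_of_int (snd (?f l)) = 660000000 * real_of_int grid *
        (params_run.type_weight k (lam k) (t l) - thr params (Suc (t l)) / (1 - thr params (ntypes params)))"
      using low[OF l] wt[OF l] by (simp add: thr_sand algebra_simps)
  qed simp
  moreover have "real_of_int max_gain =
      660000000 * real_of_int grid * (15882 / 10000 - 1 / (1 - thr params (ntypes params)))"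
    by (simp add: max_gain_def grid_def thr_sand)
  ultimately show "(\<Sum>l\<in>C. params_run.type_weight k (lam k) (t l) - thr params (Suc (t l)) / (1 - thr params (ntypes params)))
      \<le> 15882 / 10000 - 1 / (1 - thr params (ntypes params))"
    using grid by simp
qed

theorem mainTheorem2:
  "\<exists>(P :: sh_params) (A :: bp_alg).
     sh_params_ok P \<and> online_bin_packing A \<and> super_harmonic P A \<and>
     asymptotic_ratio A \<le> ereal 1.5884"
proof (intro exI conjI)
  show "sh_params_ok params" by (rule sh_params_ok_params)
  show "super_harmonic params (sh_alg params)" by (rule super_harmonic_sh_alg)
  show "online_bin_packing (sh_alg params)"
    unfolding online_bin_packing_def using params_run.level_le_1 by blast
  show "asymptotic_ratio (sh_alg params) \<le> ereal 1.5884"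
  \<comment> \<open>The patterns are bounded by 1.5882; the slack of 0.0002 absorbs the additive
    constant for large optima.\<close>
  proof (rule params_run.asymptotic_ratio_le[where lam = lam and c = "15882 / 10000"])
    show "thr params (ntypes params) < 1" by (simp add: thr_sand)
    show "0 \<le> lam k \<and> lam k \<le> 1" if "k \<in> {1..Suc (nspaces params)}" for k
      using that lam_bounds[of "k - 1"] by (auto simp: lam_def params_def)
    show "lam (Suc (nspaces params)) = 0" by (simp add: lam_def params_def lam_tab_def)
    show "(\<Sum>l\<in>B. params_run.weight k (lam k) (x l)) \<le> 15882 / 10000"
      if "k \<in> {1..Suc (nspaces params)}" "finite B" "\<And>l. l \<in> B \<Longrightarrow> 0 < x l \<and> x l \<le> 1"
        "(\<Sum>l\<in>B. x l) \<le> 1" for k and B :: "nat set" and x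
      using that by (rule pattern_weight_le)
  qed simp
qed

end
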